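(* Let $N\ge2$, $p\in(1,+\infty)$, and let $\Omega\subset\mathbb{R}^N$ be a bounded Lipschitz domain. For any $k\in\mathbb{N}$, we have $$\lambda_k^{DR}(p;\Omega)=\lambda_k^F(p;\Omega)=\lambda_k^C(p;\Omega).$$
   Context: $\mathbb{N}=\{1,2,\dots\}$; $\mathbb{S}^{m-1}$ is the unit Euclidean sphere in $\mathbb{R}^m$. A set $A$ is symmetric if $x\in A$ implies $-x\in A$. Let $\mathcal{S}(\Omega)=\{u\in W_0^{1,p}(\Omega):\int_\Omega|u|^p\,dx=1\}$ (with the topology of $W_0^{1,p}(\Omega)$) and $E(u)=\int_\Omega|\nabla u|^p\,dx$. For a symmetric set $A\subset W_0^{1,p}(\Omega)\setminus\{0\}$, the cogenus is $\gamma_F(A)=\sup\{m\in\mathbb{N}:\text{ there exists a continuous odd map }\mathbb{S}^{m-1}\to A\}$, and the regularized cogenus is $\gamma_C(A)=\sup\{m\in\mathbb{N}:\text{ for every }U\in\mathcal{N}(A)\text{ there exists a continuous odd map }\mathbb{S}^{m-1}\to U\}$, where $\mathcal{N}(A)$ is the family of open symmetric neighborhoods of $A$ in $W_0^{1,p}(\Omega)\setminus\{0\}$ (and $\sup\emptyset=0$). Define $\lambda_k^F(p;\Omega)=\inf_{A}\max_{u\in A}E(u)$, the infimum being over compact symmetric sets $A\subset\mathcal{S}(\Omega)$ with $\gamma_F(A)\ge k$; define $\lambda_k^C(p;\Omega)$ in the same way with $\gamma_C(A)\ge k$ in place of $\gamma_F(A)\ge k$; and define $\lambda_k^{DR}(p;\Omega)=\inf_A\max_{u\in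 A}E(u)$, the infimum being over all sets $A=h(\mathbb{S}^{k-1})$ where $h:\mathbb{S}^{k-1}\to\mathcal{S}(\Omega)$ is a continuous odd map. *)

theory Defs
  imports "HOL-Analysis.Analysis"
begin

subsection \<open>Lipschitz domains\<close>

text \<open>Near each boundary point, the set is the strict epigraph, in some direction \<open>\<nu>\<close>, of a
  Lipschitz function on the hyperplane orthogonal to \<open>\<nu>\<close>; \<open>y - (y \<bullet> \<nu>) *\<^sub>R \<nu>\<close> is the
  orthogonal projection of \<open>y\<close> to that hyperplane.\<close>

definition lipschitz_boundary :: "'a::euclidean_space set \<Rightarrow> bool" where
  "lipschitz_boundary \<Omega> \<longleftrightarrow>
     (\<forall>x\<in>frontier \<Omega>. \<exists>r>0. \<exists>\<nu> g L. norm \<nu> = 1 \<and> L-lipschitz_on {z. z \<bullet> \<nu> = 0} (g :: 'a \<Rightarrow> real) \<and>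
        \<Omega> \<inter> ball x r = {y \<in> ball x r. g (y - (y \<bullet> \<nu>) *\<^sub>R \<nu>) < y \<bullet> \<nu>})"

definition bounded_lipschitz_domain :: "'a::euclidean_space set \<Rightarrow> bool" where
  "bounded_lipschitz_domain \<Omega> \<longleftrightarrow>
     open \<Omega> \<and> connected \<Omega> \<and> \<Omega> \<noteq> {} \<and> bounded \<Omega> \<and> lipschitz_boundary \<Omega>"

subsection \<open>Test functions\<close>

definition partial_deriv :: "'a::euclidean_space \<Rightarrow> ('a \<Rightarrow> real) \<Rightarrow> 'a \<Rightarrow> real" where
  "partial_deriv b f x = frechet_derivative f (at x) b"

primrec iter_partial :: "'a::euclidean_space list \<Rightarrow> ('a \<Rightarrow> real) \<Rightarrow> 'a \<Rightarrow> real" where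
  "iter_partial [] f = f"
| "iter_partial (b # bs) f = partial_deriv b (iter_partial bs f)"

text \<open>Differentiability of all iterated partial derivatives makes all of them continuous, so this
  is the class of \<open>C\<^sup>\<infinity>\<close> functions.\<close>

definition smooth_fun :: "('a::euclidean_space \<Rightarrow> real) \<Rightarrow> bool" where
  "smooth_fun f \<longleftrightarrow> (\<forall>bs\<in>lists Basis. iter_partial bs f differentiable_on UNIV)"

definition test_functions :: "'a::euclidean_space set \<Rightarrow> ('a \<Rightarrow> real) set" where
  "test_functions \<Omega> =
     {\<phi>. smooth_fun \<phi> \<and> compact (closure {x. \<phi> x \<noteq> 0}) \<and> closure {x. \<phi> x \<noteq> 0} \<subseteq> \<Omega>}"

subsection \<open>Sobolev functions\<close>

definition Lp_fun :: "real \<Rightarrow> 'a::euclidean_space set \<Rightarrow> ('a \<Rightarrow> 'b::euclidean_space) \<Rightarrow> bool" where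
  "Lp_fun p \<Omega> u \<longleftrightarrow> u \<in> borel_measurable (lebesgue_on \<Omega>) \<and>
     integrable (lebesgue_on \<Omega>) (\<lambda>x. norm (u x) powr p)"

definition locally_integrable :: "'a::euclidean_space set \<Rightarrow> ('a \<Rightarrow> 'b::euclidean_space) \<Rightarrow> bool" where
  "locally_integrable \<Omega> u \<longleftrightarrow> (\<forall>K. compact K \<and> K \<subseteq> \<Omega> \<longrightarrow> set_integrable lebesgue K u)"

definition is_weak_gradient ::
    "'a::euclidean_space set \<Rightarrow> ('a \<Rightarrow> real) \<Rightarrow> ('a \<Rightarrow> 'a) \<Rightarrow> bool" where
  "is_weak_gradient \<Omega> u g \<longleftrightarrow> locally_integrable \<Omega> u \<and> locally_integrable \<Omega> g \<and>
     (\<forall>\<phi>\<in>test_functions \<Omega>. \<forall>b\<in>Basis.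
        (LINT x|lebesgue_on \<Omega>. u x * partial_deriv b \<phi> x) =
        - (LINT x|lebesgue_on \<Omega>. (g x \<bullet> b) * \<phi> x))"

text \<open>A weak gradient is unique up to null sets, so integrals over \<open>\<Omega>\<close> involving \<open>weak_grad\<close> do
  not depend on the choice.\<close>

definition weak_grad :: "'a::euclidean_space set \<Rightarrow> ('a \<Rightarrow> real) \<Rightarrow> 'a \<Rightarrow> 'a" where
  "weak_grad \<Omega> u = (SOME g. is_weak_gradient \<Omega> u g)"

definition W1p :: "real \<Rightarrow> 'a::euclidean_space set \<Rightarrow> ('a \<Rightarrow> real) set" where
  "W1p p \<Omega> = {u. Lp_fun p \<Omega> u \<and> (\<exists>g. is_weak_gradient \<Omega> u g \<and> Lp_fun p \<Omega> g)}"

definition W1p_norm :: "real \<Rightarrow> 'a::euclidean_space set \<Rightarrow> ('a \<Rightarrow> real) \<Rightarrow> real" where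
  "W1p_norm p \<Omega> u =
     ((LINT x|lebesgue_on \<Omega>. \<bar>u x\<bar> powr p) +
      (LINT x|lebesgue_on \<Omega>. norm (weak_grad \<Omega> u x) powr p)) powr (1 / p)"

definition W01p :: "real \<Rightarrow> 'a::euclidean_space set \<Rightarrow> ('a \<Rightarrow> real) set" where
  "W01p p \<Omega> = {u \<in> W1p p \<Omega>. \<exists>\<phi>. (\<forall>n. \<phi> n \<in> test_functions \<Omega>) \<and>
     (\<lambda>n. W1p_norm p \<Omega> (\<lambda>x. u x - \<phi> n x)) \<longlonglongrightarrow> 0}"

subsection \<open>The space of equivalence classes modulo almost everywhere equality\<close>

definition ae_class :: "'a::euclidean_space set \<Rightarrow> ('a \<Rightarrow> real) \<Rightarrow> ('a \<Rightarrow> real) set" where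
  "ae_class \<Omega> u =
     {v \<in> borel_measurable (lebesgue_on \<Omega>). AE x in lebesgue_on \<Omega>. v x = u x}"

definition class_rep :: "('a \<Rightarrow> real) set \<Rightarrow> 'a \<Rightarrow> real" where
  "class_rep c = (SOME u. u \<in> c)"

definition class_neg :: "('a \<Rightarrow> real) set \<Rightarrow> ('a \<Rightarrow> real) set" where
  "class_neg c = (\<lambda>u x. - u x) ` c"

definition sobolev_space :: "real \<Rightarrow> 'a::euclidean_space set \<Rightarrow> ('a \<Rightarrow> real) set set" where
  "sobolev_space p \<Omega> = ae_class \<Omega> ` W01p p \<Omega>"

definition sobolev_dist ::
    "real \<Rightarrow> 'a::euclidean_space set \<Rightarrow> ('a \<Rightarrow> real) set \<Rightarrow> ('a \<Rightarrow> real) set \<Rightarrow> real" where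
  "sobolev_dist p \<Omega> c d = W1p_norm p \<Omega> (\<lambda>x. class_rep c x - class_rep d x)"

definition sobolev_topology ::
    "real \<Rightarrow> 'a::euclidean_space set \<Rightarrow> ('a \<Rightarrow> real) set topology" where
  "sobolev_topology p \<Omega> = Metric_space.mtopology (sobolev_space p \<Omega>) (sobolev_dist p \<Omega>)"

definition sobolev_nonzero :: "real \<Rightarrow> 'a::euclidean_space set \<Rightarrow> ('a \<Rightarrow> real) set set" where
  "sobolev_nonzero p \<Omega> = sobolev_space p \<Omega> - {ae_class \<Omega> (\<lambda>_. 0)}"

definition sobolev_sphere :: "real \<Rightarrow> 'a::euclidean_space set \<Rightarrow> ('a \<Rightarrow> real) set set" where
  "sobolev_sphere p \<Omega> =
     {c \<in> sobolev_space p \<Omega>. (LINT x|lebesgue_on \<Omega>. \<bar>class_rep c x\<bar> powr p) = 1}"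

definition energy :: "real \<Rightarrow> 'a::euclidean_space set \<Rightarrow> ('a \<Rightarrow> real) set \<Rightarrow> real" where
  "energy p \<Omega> c = (LINT x|lebesgue_on \<Omega>. norm (weak_grad \<Omega> (class_rep c) x) powr p)"

definition symmetric_set :: "('a \<Rightarrow> real) set set \<Rightarrow> bool" where
  "symmetric_set A \<longleftrightarrow> (\<forall>c\<in>A. class_neg c \<in> A)"

subsection \<open>Cogenus and regularized cogenus\<close>

text \<open>The library's \<open>nsphere n\<close> is the unit sphere of dimension \<open>n\<close>, i.e. the sphere in
  \<open>n + 1\<close> coordinates, realised inside \<open>nat \<Rightarrow> real\<close>.\<close>

definition odd_map ::
    "real \<Rightarrow> 'a::euclidean_space set \<Rightarrow> nat \<Rightarrow> ('a \<Rightarrow> real) set set \<Rightarrow>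
     ((nat \<Rightarrow> real) \<Rightarrow> ('a \<Rightarrow> real) set) \<Rightarrow> bool" where
  "odd_map p \<Omega> m A h \<longleftrightarrow>
     continuous_map (nsphere (m - 1)) (subtopology (sobolev_topology p \<Omega>) A) h \<and>
     (\<forall>x\<in>topspace (nsphere (m - 1)). h (\<lambda>i. - x i) = class_neg (h x))"

definition cogenus ::
    "real \<Rightarrow> 'a::euclidean_space set \<Rightarrow> ('a \<Rightarrow> real) set set \<Rightarrow> enat" where
  "cogenus p \<Omega> A = Sup {enat m | m. 1 \<le> m \<and> (\<exists>h. odd_map p \<Omega> m A h)}"

definition symmetric_nhds ::
    "real \<Rightarrow> 'a::euclidean_space set \<Rightarrow> ('a \<Rightarrow> real) set set \<Rightarrow> ('a \<Rightarrow> real) set set set" where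
  "symmetric_nhds p \<Omega> A =
     {U. openin (subtopology (sobolev_topology p \<Omega>) (sobolev_nonzero p \<Omega>)) U \<and>
         symmetric_set U \<and> A \<subseteq> U}"

definition reg_cogenus ::
    "real \<Rightarrow> 'a::euclidean_space set \<Rightarrow> ('a \<Rightarrow> real) set set \<Rightarrow> enat" where
  "reg_cogenus p \<Omega> A =
     Sup {enat m | m. 1 \<le> m \<and> (\<forall>U\<in>symmetric_nhds p \<Omega> A. \<exists>h. odd_map p \<Omega> m U h)}"

subsection \<open>Variational eigenvalues\<close>

text \<open>All sets admitted below are compact and nonempty, so \<open>SUP c\<in>A. ereal (energy p \<Omega> c)\<close> is the
  maximum of the energy on \<open>A\<close>. With values in \<open>ereal\<close>, \<open>Inf\<close> follows the usual convention
  that the infimum over the empty family is \<open>\<infinity>\<close>.\<close>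

definition minimax ::
    "real \<Rightarrow> 'a::euclidean_space set \<Rightarrow> ('a \<Rightarrow> real) set set set \<Rightarrow> ereal" where
  "minimax p \<Omega> \<A> = (INF A\<in>\<A>. SUP c\<in>A. ereal (energy p \<Omega> c))"

definition compact_symmetric_sets ::
    "real \<Rightarrow> 'a::euclidean_space set \<Rightarrow> ('a \<Rightarrow> real) set set set" where
  "compact_symmetric_sets p \<Omega> =
     {A. compactin (sobolev_topology p \<Omega>) A \<and> symmetric_set A \<and> A \<subseteq> sobolev_sphere p \<Omega>}"

definition lambda_F :: "nat \<Rightarrow> real \<Rightarrow> 'a::euclidean_space set \<Rightarrow> ereal" where
  "lambda_F k p \<Omega> =
     minimax p \<Omega> {A \<in> compact_symmetric_sets p \<Omega>. enat k \<le> cogenus p \<Omega> A}"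

definition lambda_C :: "nat \<Rightarrow> real \<Rightarrow> 'a::euclidean_space set \<Rightarrow> ereal" where
  "lambda_C k p \<Omega> =
     minimax p \<Omega> {A \<in> compact_symmetric_sets p \<Omega>. enat k \<le> reg_cogenus p \<Omega> A}"

definition lambda_DR :: "nat \<Rightarrow> real \<Rightarrow> 'a::euclidean_space set \<Rightarrow> ereal" where
  "lambda_DR k p \<Omega> =
     minimax p \<Omega> {h ` topspace (nsphere (k - 1)) | h. odd_map p \<Omega> k (sobolev_sphere p \<Omega>) h}"

end

theory Submission
  imports Defs "HOL-Computational_Algebra.Polynomial"
begin

text \<open>Images of odd maps on the sphere are admissible for \<open>lambda_F\<close>, and the cogenus is at most the
  regularized cogenus, so \<open>lambda_C \<le> lambda_F \<le> lambda_DR\<close>. Conversely, if \<open>A\<close> has regularized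
  cogenus at least \<open>k\<close> and energy below \<open>M\<close>, then \<open>{u. E u < M * \<parallel>u\<parallel>\<^sub>p\<^sup>p}\<close> is an open symmetric
  neighbourhood of \<open>A\<close> avoiding \<open>0\<close>. It receives an odd map from some sphere of dimension at least
  \<open>k - 1\<close>; restricting this map to an equator and dividing by the \<open>L\<^sup>p\<close> norm gives an odd map into
  the unit sphere with energy below \<open>M\<close>.

  Most of the work is to see that the Sobolev distance is a metric at all: this needs the Minkowski
  inequality, uniqueness of weak gradients through the fundamental lemma of the calculus of
  variations, and integration by parts for test functions.\<close>

subsection \<open>The Minkowski inequality for convex homogeneous integrands\<close>

text \<open>The neighbourhood is a cone: the energy and the \<open>p\<close>-th power of the
  \<open>L^p\<close> norm have the same degree \<open>p\<close>, so division by the norm leaves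
  their quotient unchanged, and a bound on the quotient becomes a bound on the energy over the unit
  sphere. The bound \<open>M\<close> has to exceed the maximum on \<open>A\<close> strictly, since
  \<open>A\<close> must lie inside an open set; hence the inequality is proved for every such
  \<open>M\<close> and not for the maximum itself. Energy and norm enter through their
  \<open>p\<close>-th roots, which are homogeneous of degree one and 1-Lipschitz for the Sobolev
  distance, so openness is immediate. The obstacle is that class representatives and weak gradients
  are arbitrary choices: identities such as linearity of the gradient hold only almost everywhere,
  by uniqueness of weak gradients, and every norm has to be shown independent of the choice before
  it can be used.\<close>

lemma convex_on_norm_powr:
  fixes p :: real
  assumes "1 \<le> p"
  shows "convex_on UNIV (\<lambda>y::'b::real_normed_vector. norm y powr p)"
proof (rule convex_onI)
  fix t :: real and x y :: 'b
  assume t: "0 < t" "t < 1"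
  have "norm ((1 - t) *\<^sub>R x + t *\<^sub>R y) \<le> (1 - t) * norm x + t * norm y"
    using t by (intro order_trans[OF norm_triangle_ineq]) simp
  then have "norm ((1 - t) *\<^sub>R x + t *\<^sub>R y) powr p \<le> ((1 - t) * norm x + t * norm y) powr p"
    using assms by (intro powr_mono2) auto
  also have "\<dots> \<le> (1 - t) * norm x powr p + t * norm y powr p"
  proof -
    \<comment> \<open>An endpoint 0 is treated apart, where the inequality reduces to
      \<open>s powr p \<le> s\<close> for \<open>0 < s < 1\<close>; case 3 is convexity on the
      positive reals.\<close>
    have "convex_on {0..} (\<lambda>r::real. r powr p)"
    proof (rule convex_onI)
      fix t a b :: real
      assume t: "0 < t" "t < 1" and ab: "a \<in> {0..}" "b \<in> {0..}"
      have *: "s powr p \<le> s" if "0 < s" "s < 1" for s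
        using powr_mono'[of 1 p s] that assms by simp
      consider "a = 0" | "b = 0" | "0 < a" "0 < b"
        using ab by fastforce
      then show "((1 - t) *\<^sub>R a + t *\<^sub>R b) powr p \<le> (1 - t) * a powr p + t * b powr p"
      proof cases
        case 1
        then show ?thesis
          using *[of t] t ab assms by (simp add: powr_mult mult_right_mono)
      next
        case 2
        then show ?thesis
          using *[of "1 - t"] t ab assms by (simp add: powr_mult mult_right_mono)
      next
        case 3
        then show ?thesis
          using convex_onD[OF powr_convex[OF assms], of t a b] t by simp
      qed
    qed auto
    from convex_onD[OF this, of t "norm x" "norm y"] show ?thesis
      using t by simp
  qed
  finally show "norm ((1 - t) *\<^sub>R x + t *\<^sub>R y) powr p \<le> (1 - t) * norm x powr p + t * norm y powr p" .
qed auto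

text \<open>An abstraction of \<open>norm y powr p\<close>, so that one Minkowski proof serves
  scalar functions, vector fields, and the pairs of a function and its gradient, whose gauge is a
  sum of two \<open>p\<close>-th powers.\<close>

locale homogeneous_gauge =
  fixes q :: "'b::real_vector \<Rightarrow> real" and p :: real
  assumes p_pos: "0 < p"
    and nonneg: "0 \<le> q y"
    and convex: "convex_on UNIV q"
    and homogeneous: "q (c *\<^sub>R y) = \<bar>c\<bar> powr p * q y"
begin

text \<open>For \<open>s\<close> and \<open>r\<close> slightly larger than the two terms on the right,
  \<open>(y + z) / (s + r)\<close> is the convex combination of \<open>y / s\<close> and \<open>z / r\<close> with weights
  \<open>s / (s + r)\<close> and \<open>r / (s + r)\<close>, and each of these has integral at most \<open>1\<close>.\<close>

lemma minkowski:
  assumes F: "integrable M (\<lambda>x. q (F x))" and G: "integrable M (\<lambda>x. q (G x))"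
  shows "(LINT x|M. q (F x + G x)) powr (1 / p) \<le>
    (LINT x|M. q (F x)) powr (1 / p) + (LINT x|M. q (G x)) powr (1 / p)"
proof -
  define a where "a = (LINT x|M. q (F x))"
  define b where "b = (LINT x|M. q (G x))"
  define c where "c = (LINT x|M. q (F x + G x))"
  have nn: "0 \<le> a" "0 \<le> b" "0 \<le> c"
    unfolding a_def b_def c_def by (auto intro!: integral_nonneg_AE simp: nonneg)
  have key: "c powr (1 / p) \<le> s + r" if s: "a powr (1 / p) < s" and r: "b powr (1 / p) < r" for s r
  proof -
    have pos: "0 < s" "0 < r"
      using s r by (meson powr_ge_zero le_less_trans)+
    have ar: "a \<le> s powr p" "b \<le> r powr p"
      using powr_mono2[of p "a powr (1/p)" s] powr_mono2[of p "b powr (1/p)" r] s r nn p_pos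
      by (auto simp: powr_powr)
    have pt: "q (F x + G x) \<le> (s + r) powr p *
        (s / (s + r) * (q (F x) / s powr p) + r / (s + r) * (q (G x) / r powr p))" for x
    proof -
      have eq: "F x + G x = (s + r) *\<^sub>R ((1 - r / (s + r)) *\<^sub>R ((1 / s) *\<^sub>R F x) + (r / (s + r)) *\<^sub>R ((1 / r) *\<^sub>R G x))"
        using pos by (simp add: scaleR_add_right field_simps)
      have "q (F x + G x) = (s + r) powr p *
         q ((1 - r / (s + r)) *\<^sub>R ((1 / s) *\<^sub>R F x) + (r / (s + r)) *\<^sub>R ((1 / r) *\<^sub>R G x))"
        using pos by (subst eq, subst homogeneous) simp
      also have "\<dots> \<le> (s + r) powr p *
         ((1 - r / (s + r)) * q ((1 / s) *\<^sub>R F x) + (r / (s + r)) * q ((1 / r) *\<^sub>R G x))"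
        using pos by (intro mult_left_mono convex_onD[OF convex]) (auto simp: field_simps)
      also have "\<dots> = (s + r) powr p *
        (s / (s + r) * (q (F x) / s powr p) + r / (s + r) * (q (G x) / r powr p))"
      proof -
        have "1 - r / (s + r) = s / (s + r)"
          using pos by (simp add: field_simps)
        then show ?thesis
          using pos by (simp only: homogeneous) (simp add: powr_divide)
      qed
      finally show ?thesis .
    qed
    let ?R = "\<lambda>x. (s + r) powr p *
        (s / (s + r) * (q (F x) / s powr p) + r / (s + r) * (q (G x) / r powr p))"
    have intR: "integrable M ?R"
      using F G by auto
    \<comment> \<open>Nothing here makes \<open>q (F x + G x)\<close> integrable; if it is not, its
      integral is 0 by convention and the bound holds because \<open>?R\<close> is
      nonnegative.\<close>
    have "c \<le> (LINT x|M. ?R x)"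
      unfolding c_def using pt nonneg by (intro integral_mono_AE' intR) (auto intro: order_trans[OF nonneg])
    also have "\<dots> = (s + r) powr p * (s / (s + r) * (a / s powr p) + r / (s + r) * (b / r powr p))"
      using F G by (simp add: a_def b_def)
    also have "\<dots> \<le> (s + r) powr p * (s / (s + r) * 1 + r / (s + r) * 1)"
      using pos ar by (intro mult_left_mono add_mono) (auto simp: divide_le_eq_1)
    also have "\<dots> = (s + r) powr p"
      using pos by (simp flip: add_divide_distrib)
    finally have "c powr (1 / p) \<le> ((s + r) powr p) powr (1 / p)"
      using nn p_pos by (intro powr_mono2) auto
    then show ?thesis
      using pos p_pos by (simp add: powr_powr)
  qed
  \<comment> \<open>The excess \<open>e/2\<close> in each term keeps the divisors \<open>s\<close>
    and \<open>r\<close> positive even when \<open>a\<close> or \<open>b\<close> is 0.\<close>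
  have "c powr (1 / p) \<le> a powr (1 / p) + b powr (1 / p) + e" if "0 < e" for e
    using key[of "a powr (1/p) + e/2" "b powr (1/p) + e/2"] that by (simp add: algebra_simps)
  then show ?thesis
    unfolding a_def b_def c_def by (rule field_le_epsilon)
qed

lemma integral_scale:
  "(LINT x|M. q (c *\<^sub>R F x)) powr (1 / p) = \<bar>c\<bar> * (LINT x|M. q (F x)) powr (1 / p)"
  using p_pos by (simp add: homogeneous powr_mult powr_powr integral_nonneg_AE nonneg)

text \<open>Convexity at the midpoint, after a factor 2 is pulled out by homogeneity. The constant
  is crude because the bound only has to dominate \<open>p\<close>-th powers of sums by an
  integrable function.\<close>

lemma add_le: "q (y + z) \<le> 2 powr p * (q y + q z)"
proof -
  have "q (y + z) = 2 powr p * q ((1 - 1/2) *\<^sub>R y + (1/2) *\<^sub>R z)"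
    using homogeneous[of 2 "(1 - 1/2) *\<^sub>R y + (1/2) *\<^sub>R z"] by (simp add: scaleR_add_right)
  also have "\<dots> \<le> 2 powr p * ((1 - 1/2) * q y + (1/2) * q z)"
    by (intro mult_left_mono convex_onD[OF convex]) auto
  also have "\<dots> \<le> 2 powr p * (q y + q z)"
    using nonneg[of y] nonneg[of z] by (intro mult_left_mono) auto
  finally show ?thesis .
qed

end

lemma homogeneous_gauge_norm:
  "1 \<le> p \<Longrightarrow> homogeneous_gauge (\<lambda>y::'b::real_normed_vector. norm y powr p) p"
  by unfold_locales (auto simp: convex_on_norm_powr powr_mult)

lemma homogeneous_gauge_prod:
  assumes "homogeneous_gauge q p" and "homogeneous_gauge q' p"
  shows "homogeneous_gauge (\<lambda>z. q (fst z) + q' (snd z)) p"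
proof -
  interpret q: homogeneous_gauge q p by fact
  interpret q': homogeneous_gauge q' p by fact
  show ?thesis
  proof
    show "convex_on UNIV (\<lambda>z. q (fst z) + q' (snd z))"
    proof (rule convex_onI)
      fix t :: real and x y :: "'a \<times> 'b"
      assume "0 < t" "t < 1"
      then show "q (fst ((1 - t) *\<^sub>R x + t *\<^sub>R y)) + q' (snd ((1 - t) *\<^sub>R x + t *\<^sub>R y))
          \<le> (1 - t) * (q (fst x) + q' (snd x)) + t * (q (fst y) + q' (snd y))"
        using convex_onD[OF q.convex, of t "fst x" "fst y"]
          convex_onD[OF q'.convex, of t "snd x" "snd y"] by (simp add: algebra_simps)
    qed auto
  qed (auto simp: q.p_pos q.nonneg q'.nonneg q.homogeneous q'.homogeneous distrib_left add_nonneg_nonneg)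
qed

subsection \<open>Bump functions and the fundamental lemma of the calculus of variations\<close>

text \<open>The classical smooth function that is flat at 0, with a polynomial factor in 1/t: the
  family over all \<open>P\<close> is closed under differentiation, while its member
  \<open>flat_exp 1\<close> alone is not.\<close>

definition flat_exp :: "real poly \<Rightarrow> real \<Rightarrow> real" where
  "flat_exp P t = (if 0 < t then poly P (1 / t) * exp (- (1 / t)) else 0)"

lemma poly_times_exp_uminus_tendsto_0:
  "((\<lambda>s. poly P s * exp (- s)) \<longlongrightarrow> (0::real)) at_top"
proof -
  have "((\<lambda>s. \<Sum>i\<le>degree P. coeff P i * (s ^ i / exp s)) \<longlongrightarrow> (\<Sum>i\<le>degree P. coeff P i * 0)) at_top"
    by (intro tendsto_sum tendsto_mult tendsto_const tendsto_power_div_exp_0)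
  then show ?thesis
    by (simp add: poly_altdef sum_distrib_right exp_minus divide_inverse mult.assoc)
qed

text \<open>Write s = 1/t, so ds/dt = -s^2. Differentiating P(s) exp(-s) gives s^2 (P(s) - P'(s))
  exp(-s), and \<open>[:0, 0, 1:]\<close> is the polynomial s^2. Left of 0 the function is constant,
  so only t = 0 needs a limit.\<close>

lemma has_real_derivative_flat_exp:
  "(flat_exp P has_real_derivative flat_exp ([:0, 0, 1:] * (P - pderiv P)) t) (at t)"
proof -
  consider "t < 0" | "t = 0" | "0 < t"
    by linarith
  then show ?thesis
  proof cases
    case 1
    have "(flat_exp P has_real_derivative 0) (at t) \<longleftrightarrow> ((\<lambda>_. 0) has_real_derivative 0) (at t)"
    proof (rule DERIV_cong_ev)
      show "\<forall>\<^sub>F x in nhds t. flat_exp P x = 0"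
        using 1 by (auto simp: eventually_nhds flat_exp_def intro!: exI[of _ "{..<0}"])
    qed auto
    then show ?thesis
      using 1 by (simp add: flat_exp_def)
  next
    case 2
    have "((\<lambda>h. flat_exp P h / h) \<longlongrightarrow> 0) (at_left 0)"
      by (rule tendsto_eventually) (auto simp: eventually_at_filter flat_exp_def)
    moreover have "((\<lambda>h. flat_exp P h / h) \<longlongrightarrow> 0) (at_right 0)"
    proof -
      \<comment> \<open>Dividing by h = 1/s multiplies by s, which is again a polynomial factor; the
        exponential beats it.\<close>
      have "((\<lambda>h. poly ([:0, 1:] * P) (inverse h) * exp (- inverse h)) \<longlongrightarrow> (0::real)) (at_right 0)"
        by (rule filterlim_compose[OF poly_times_exp_uminus_tendsto_0 filterlim_inverse_at_top_right])
      moreover have "\<forall>\<^sub>F h in at_right 0. poly ([:0, 1:] * P) (inverse h) * exp (- inverse h) = flat_exp P h / h"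
        by (auto simp: eventually_at_filter flat_exp_def divide_inverse)
      ultimately show ?thesis
        by (rule Lim_transform_eventually)
    qed
    ultimately have "((\<lambda>h. flat_exp P h / h) \<longlongrightarrow> 0) (at 0)"
      by (simp add: filterlim_at_split)
    then show ?thesis
      using 2 by (simp add: has_field_derivative_iff flat_exp_def)
  next
    case 3
    have "((\<lambda>t. poly P (1 / t) * exp (- (1 / t))) has_real_derivative
        (poly (pderiv P) (1 / t) * (- (1 / t\<^sup>2))) * exp (- (1 / t)) +
        (exp (- (1 / t)) * (1 / t\<^sup>2)) * poly P (1 / t)) (at t)"
      using 3 by (auto intro!: derivative_eq_intros DERIV_chain2[OF poly_DERIV] simp: power2_eq_square)
    also have "(poly (pderiv P) (1 / t) * (- (1 / t\<^sup>2))) * exp (- (1 / t)) +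
        (exp (- (1 / t)) * (1 / t\<^sup>2)) * poly P (1 / t) = flat_exp ([:0, 0, 1:] * (P - pderiv P)) t"
      using 3 by (simp add: flat_exp_def power2_eq_square field_simps)
    finally have *: "((\<lambda>t. poly P (1 / t) * exp (- (1 / t))) has_real_derivative
        flat_exp ([:0, 0, 1:] * (P - pderiv P)) t) (at t)" .
    have "(flat_exp P has_real_derivative flat_exp ([:0, 0, 1:] * (P - pderiv P)) t) (at t) \<longleftrightarrow>
      ((\<lambda>t. poly P (1 / t) * exp (- (1 / t))) has_real_derivative
        flat_exp ([:0, 0, 1:] * (P - pderiv P)) t) (at t)"
    proof (rule DERIV_cong_ev)
      show "\<forall>\<^sub>F x in nhds t. flat_exp P x = poly P (1 / x) * exp (- (1 / x))"
        using 3 by (auto simp: eventually_nhds flat_exp_def intro!: exI[of _ "{0<..}"])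
    qed auto
    then show ?thesis
      using * by simp
  qed
qed

text \<open>Being closed under partial derivatives, this class consists of smooth functions.\<close>

inductive_set bump_algebra :: "('a::euclidean_space \<Rightarrow> real) set" where
  flat: "(\<lambda>x. flat_exp P (x \<bullet> v + \<beta>)) \<in> bump_algebra"
| add: "f \<in> bump_algebra \<Longrightarrow> g \<in> bump_algebra \<Longrightarrow> (\<lambda>x. f x + g x) \<in> bump_algebra"
| mult: "f \<in> bump_algebra \<Longrightarrow> g \<in> bump_algebra \<Longrightarrow> (\<lambda>x. f x * g x) \<in> bump_algebra"

lemma partial_deriv_eqI:
  "(f has_derivative f') (at x) \<Longrightarrow> partial_deriv b f x = f' b"
  by (simp add: partial_deriv_def frechet_derivative_at[symmetric])

lemma flat_exp_has_derivative:
  fixes v :: "'a::euclidean_space"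
  shows "((\<lambda>x. flat_exp P (x \<bullet> v + \<beta>)) has_derivative
    (\<lambda>h. flat_exp ([:0, 0, 1:] * (P - pderiv P)) (x \<bullet> v + \<beta>) * (h \<bullet> v))) (at x)"
proof -
  have "((\<lambda>x. x \<bullet> v + \<beta>) has_derivative (\<lambda>h. h \<bullet> v)) (at x)"
    by (auto intro!: derivative_eq_intros)
  from has_derivative_compose[OF this
      has_real_derivative_flat_exp[unfolded has_field_derivative_def, of P "x \<bullet> v + \<beta>"]]
  show ?thesis .
qed

lemma flat_exp_smult: "flat_exp (smult c P) t = c * flat_exp P t"
  by (simp add: flat_exp_def)

text \<open>Both claims go through one induction, because the sum and product rules for
  \<open>partial_deriv\<close> need the differentiability of the two parts.\<close>

lemma bump_algebra_deriv:
  assumes "f \<in> bump_algebra"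
  shows "f differentiable (at x) \<and> partial_deriv b f \<in> bump_algebra"
  using assms
proof (induction arbitrary: x rule: bump_algebra.induct)
  case (flat P v \<beta>)
  \<comment> \<open>The class has no rule for scalar multiples, so the inner derivative
    \<open>b \<bullet> v\<close> is absorbed into the polynomial.\<close>
  have "partial_deriv b (\<lambda>x. flat_exp P (x \<bullet> v + \<beta>)) =
    (\<lambda>x. flat_exp (smult (b \<bullet> v) ([:0, 0, 1:] * (P - pderiv P))) (x \<bullet> v + \<beta>))"
    by (rule ext) (simp only: partial_deriv_eqI[OF flat_exp_has_derivative] flat_exp_smult mult.commute)
  then show ?case
    using flat_exp_has_derivative differentiable_def by (metis bump_algebra.flat)
next
  case (add f g)
  have "partial_deriv b (\<lambda>x. f x + g x) = (\<lambda>x. partial_deriv b f x + partial_deriv b g x)"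
  proof
    fix x
    have "(f has_derivative frechet_derivative f (at x)) (at x)"
      "(g has_derivative frechet_derivative g (at x)) (at x)"
      using add.IH by (simp_all add: frechet_derivative_works[symmetric])
    from has_derivative_add[OF this]
    show "partial_deriv b (\<lambda>x. f x + g x) x = partial_deriv b f x + partial_deriv b g x"
      by (simp add: partial_deriv_eqI) (simp add: partial_deriv_def)
  qed
  then show ?case
    using add.IH by (auto intro: bump_algebra.add)
next
  case (mult f g)
  have "partial_deriv b (\<lambda>x. f x * g x) = (\<lambda>x. f x * partial_deriv b g x + partial_deriv b f x * g x)"
  proof
    fix x
    have "(f has_derivative frechet_derivative f (at x)) (at x)"
      "(g has_derivative frechet_derivative g (at x)) (at x)"
      using mult.IH by (simp_all add: frechet_derivative_works[symmetric])
    from has_derivative_mult[OF this]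
    show "partial_deriv b (\<lambda>x. f x * g x) x = f x * partial_deriv b g x + partial_deriv b f x * g x"
      by (simp add: partial_deriv_eqI) (simp add: partial_deriv_def)
  qed
  then show ?case
    using mult.IH mult.hyps by (simp add: bump_algebra.add bump_algebra.mult)
qed

lemma smooth_fun_bump_algebra:
  assumes "f \<in> bump_algebra"
  shows "smooth_fun f"
proof -
  have "iter_partial bs f \<in> bump_algebra" for bs
    by (induction bs) (simp_all add: assms bump_algebra_deriv)
  then show ?thesis
    unfolding smooth_fun_def by (simp add: bump_algebra_deriv differentiable_at_imp_differentiable_on)
qed

text \<open>Each pair of factors vanishes outside the slab between the two faces orthogonal to
  \<open>i\<close>. Inside, steepening by \<open>n\<close> drives exp(-1/(n t)) to 1, so these
  functions with values in [0, 1] converge pointwise to the indicator of the open box.\<close>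

definition box_bump :: "nat \<Rightarrow> 'a::euclidean_space \<Rightarrow> 'a \<Rightarrow> 'a \<Rightarrow> real" where
  "box_bump n a b x = (\<Prod>i\<in>Basis. flat_exp 1 (real n * (x \<bullet> i - a \<bullet> i)) * flat_exp 1 (real n * (b \<bullet> i - x \<bullet> i)))"

lemma flat_exp_1_bounds: "0 \<le> flat_exp 1 t" "flat_exp 1 t \<le> 1"
  by (simp_all add: flat_exp_def)

lemma box_bump_bounds: "0 \<le> box_bump n a b x" "box_bump n a b x \<le> 1"
  unfolding box_bump_def
  by (intro prod_nonneg prod_le_1 conjI mult_nonneg_nonneg mult_le_one flat_exp_1_bounds ballI)+

lemma box_bump_eq_0: "x \<notin> box a b \<Longrightarrow> box_bump n a b x = 0"
  unfolding box_bump_def prod_zero_iff[OF finite_Basis]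
  by (force simp: mem_box flat_exp_def zero_less_mult_iff)

lemma box_bump_tendsto_indicator:
  "(\<lambda>n. box_bump n a b x) \<longlonglongrightarrow> indicator (box a b) x"
proof (cases "x \<in> box a b")
  case True
  have *: "(\<lambda>n. flat_exp 1 (real n * t)) \<longlonglongrightarrow> 1" if "0 < t" for t
  proof -
    have "(\<lambda>n. exp (- (1 / t * inverse (real n)))) \<longlonglongrightarrow> exp (- (1 / t * 0))"
      by (intro tendsto_intros lim_inverse_n)
    moreover have "\<forall>\<^sub>F n in sequentially. exp (- (1 / t * inverse (real n))) = flat_exp 1 (real n * t)"
      using eventually_gt_at_top[of 0]
      by eventually_elim (use that in \<open>simp add: flat_exp_def divide_inverse mult.commute\<close>)
    ultimately show ?thesis
      by (simp cong: filterlim_cong add: Lim_transform_eventually)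
  qed
  have "(\<lambda>n. box_bump n a b x) \<longlonglongrightarrow> (\<Prod>i\<in>(Basis::'a set). 1 * 1)"
    unfolding box_bump_def using True by (intro tendsto_prod tendsto_mult *) (auto simp: mem_box)
  then show ?thesis
    using True by simp
next
  case False
  then show ?thesis
    by (simp add: box_bump_eq_0)
qed

lemma box_bump_in_bump_algebra: "box_bump n a b \<in> bump_algebra"
proof -
  \<comment> \<open>No rule of \<open>bump_algebra\<close> yields an empty product, so the induction
    starts from a single factor.\<close>
  have "(\<lambda>x. \<Prod>i\<in>B. flat_exp 1 (real n * (x \<bullet> i - a \<bullet> i)) * flat_exp 1 (real n * (b \<bullet> i - x \<bullet> i))) \<in> bump_algebra"
    if "finite B" "B \<noteq> {}" for B :: "'a set"
    using that
  proof (induction rule: finite_ne_induct)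
    have *: "(\<lambda>x. flat_exp 1 (real n * (x \<bullet> i - a \<bullet> i)) * flat_exp 1 (real n * (b \<bullet> i - x \<bullet> i))) \<in> bump_algebra" for i
    proof -
      have "(\<lambda>x. flat_exp 1 (x \<bullet> (real n *\<^sub>R i) + (- real n * (a \<bullet> i))) *
          flat_exp 1 (x \<bullet> (- real n *\<^sub>R i) + real n * (b \<bullet> i))) \<in> bump_algebra"
        by (intro bump_algebra.intros)
      then show ?thesis
        by (simp add: algebra_simps)
    qed
    {
      case (singleton i)
      then show ?case using * by simp
    next
      case (insert i F)
      then show ?case using bump_algebra.mult[OF *[of i] insert.IH] by simp
    }
  qed
  from this[OF finite_Basis nonempty_Basis] show ?thesis
    unfolding box_bump_def[abs_def] .
qed

lemma box_bump_test_function: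
  assumes "cbox a b \<subseteq> \<Omega>"
  shows "box_bump n a b \<in> test_functions \<Omega>"
proof -
  have "closure {x. box_bump n a b x \<noteq> 0} \<subseteq> cbox a b"
    using box_bump_eq_0 box_subset_cbox by (intro closure_minimal closed_cbox) blast
  moreover from this have "compact (closure {x. box_bump n a b x \<noteq> 0})"
    by (meson bounded_cbox bounded_subset closed_closure compact_eq_bounded_closed)
  ultimately show ?thesis
    using assms by (auto simp: test_functions_def smooth_fun_bump_algebra box_bump_in_bump_algebra)
qed

section \<open>From vanishing integrals to vanishing almost everywhere\<close>

text \<open>Boxes are stable under intersection and generate the Borel sets, so Dynkin's pi-lambda
  argument extends the vanishing to all Borel sets. The assumption \<open>total\<close> supplies the
  step to complements.\<close>

lemma AE_eq_0_if_box_integrals_eq_0: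
  fixes f :: "'a::euclidean_space \<Rightarrow> real"
  assumes f: "integrable lebesgue f" and box0: "\<And>a b. (LINT x:box a b|lebesgue. f x) = 0"
    and total: "integral\<^sup>L lebesgue f = 0"
  shows "AE x in lebesgue. f x = 0"
proof -
  \<comment> \<open>Boxes generate only the Borel sets, while \<open>f\<close> is Lebesgue
    measurable; a Borel version that agrees almost everywhere bridges the gap.\<close>
  obtain f' where f'[measurable]: "f' \<in> borel_measurable lborel" and ae: "AE x in lborel. f x = f' x"
    using completion_ex_borel_measurable_real[of f lborel] f by auto
  have ae': "AE x in lebesgue. f x = f' x"
    using ae by (rule AE_completion)
  have int: "integrable lebesgue f'"
    using f ae' by (subst integrable_cong_AE[symmetric, of f]) (auto simp: measurable_completion)
  then have intb: "integrable lborel f'"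
    by (simp add: integrable_completion)
  have eq: "(LINT x:A|lborel. f' x) = (LINT x:A|lebesgue. f x)" if [measurable]: "A \<in> sets borel" for A
  proof -
    have "(LINT x:A|lborel. f' x) = (LINT x:A|lebesgue. f' x)"
      unfolding set_lebesgue_integral_def by (subst integral_completion) auto
    also have "\<dots> = (LINT x:A|lebesgue. f x)"
      unfolding set_lebesgue_integral_def
    proof (rule integral_cong_AE)
      show "(\<lambda>x. indicat_real A x *\<^sub>R f' x) \<in> borel_measurable lebesgue"
        by (rule measurable_completion) measurable
      show "(\<lambda>x. indicat_real A x *\<^sub>R f x) \<in> borel_measurable lebesgue"
        using f that by (intro borel_measurable_scaleR borel_measurable_indicator) auto
    qed (use ae' in auto)
    finally show ?thesis .
  qed
  have setint: "set_integrable lborel A f'" if "A \<in> sets borel" for A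
    unfolding set_integrable_def using that intb by (intro integrable_mult_indicator) auto
  have "(LINT x:A|lborel. f' x) = 0" if A: "A \<in> sets borel" for A
  proof -
    have gen_A: "A \<in> sigma_sets UNIV (range (\<lambda>(a, b). box a b :: 'a set))"
      using A by (simp add: borel_eq_box)
    have gen: "range (\<lambda>(a, b). box a b :: 'a set) \<subseteq> Pow UNIV"
      by simp
    have stable: "Int_stable (range (\<lambda>(a, b). box a b :: 'a set))"
      by (auto simp: Int_stable_def box_Int_box)
    from stable gen gen_A show ?thesis
    proof (induct rule: sigma_sets_induct_disjoint)
      case (basic A)
      then show ?case
        using eq box0 by auto
    next
      case (compl A)
      then have [measurable]: "A \<in> sets borel"
        by (simp add: borel_eq_box)
      have "(LINT x:UNIV|lborel. f' x) = (LINT x:A|lborel. f' x) + (LINT x:UNIV - A|lborel. f' x)"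
        by (subst set_integral_Un[symmetric]) (auto intro!: setint)
      moreover have "(LINT x:UNIV|lborel. f' x) = 0"
        using total by (subst eq) (auto simp: set_lebesgue_integral_def)
      ultimately show ?case
        using compl by simp
    next
      case (union A)
      then have "A i \<in> sets borel" for i
        by (auto simp: borel_eq_box)
      then show ?case
        using union by (subst lebesgue_integral_countable_add)
          (auto simp: disjoint_family_on_def intro!: setint)
    qed (simp add: set_lebesgue_integral_def)
  qed
  then have "AE x in lborel. f' x = 0"
    using intb by (intro density_unique_real) (auto simp: set_lebesgue_integral_def)
  then have "AE x in lborel. f x = 0"
    using ae by eventually_elim simp
  then show ?thesis
    by (rule AE_completion)
qed

text \<open>Smooth bumps tending to the indicator of an open box show that \<open>g\<close> has
  integral 0 over each box whose closed box lies in \<Omega>. The preceding lemma then applies on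
  one closed box at a time, and countably many of them cover \<Omega>.\<close>

lemma fundamental_lemma_calculus_of_variations:
  fixes g :: "'a::euclidean_space \<Rightarrow> real"
  assumes "open \<Omega>" and g: "locally_integrable \<Omega> g"
    and test: "\<And>\<phi>. \<phi> \<in> test_functions \<Omega> \<Longrightarrow> (LINT x|lebesgue_on \<Omega>. g x * \<phi> x) = 0"
  shows "AE x in lebesgue_on \<Omega>. g x = 0"
proof -
  have \<Omega>: "\<Omega> \<in> sets lebesgue"
    using \<open>open \<Omega>\<close> by auto
  have intK: "integrable lebesgue (\<lambda>x. indicator (cbox a b) x * g x)" if "cbox a b \<subseteq> \<Omega>" for a b
    using g that by (auto simp: locally_integrable_def set_integrable_def)
  have box0: "(\<integral>x. indicator (box a b) x * g x \<partial>lebesgue) = 0" if ab: "cbox a b \<subseteq> \<Omega>" for a b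
  proof -
    \<comment> \<open>The indicator of the closed box is inserted because \<open>g\<close> is only
      locally integrable: the cut-off of \<open>g\<close> dominates all the integrands.\<close>
    have "(\<lambda>n. \<integral>x. box_bump n a b x * (indicator (cbox a b) x * g x) \<partial>lebesgue) \<longlonglongrightarrow>
        (\<integral>x. indicator (box a b) x * (indicator (cbox a b) x * g x) \<partial>lebesgue)"
    proof (rule integral_dominated_convergence)
      show "integrable lebesgue (\<lambda>x. norm (indicator (cbox a b) x * g x))"
        using intK[OF ab] by (rule integrable_norm)
      have "continuous_on UNIV (box_bump n a b)" for n
        by (intro continuous_at_imp_continuous_on ballI differentiable_imp_continuous_within)
          (simp add: bump_algebra_deriv[OF box_bump_in_bump_algebra])
      then have "box_bump n a b \<in> borel_measurable lebesgue" for n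
        by (intro measurable_completion) (auto intro: borel_measurable_continuous_onI)
      then show "(\<lambda>x. box_bump n a b x * (indicator (cbox a b) x * g x)) \<in> borel_measurable lebesgue" for n
        by (rule borel_measurable_times[OF _ borel_measurable_integrable[OF intK[OF ab]]])
      show "(\<lambda>x. indicator (box a b) x * (indicator (cbox a b) x * g x)) \<in> borel_measurable lebesgue"
        by (rule borel_measurable_times[OF borel_measurable_indicator borel_measurable_integrable[OF intK[OF ab]]]) simp
      show "AE x in lebesgue. norm (box_bump n a b x * (indicator (cbox a b) x * g x))
          \<le> norm (indicator (cbox a b) x * g x)" for n
        using box_bump_bounds[of n a b] by (auto simp: abs_mult mult_left_le_one_le)
      show "AE x in lebesgue. (\<lambda>n. box_bump n a b x * (indicator (cbox a b) x * g x)) \<longlonglongrightarrow>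
          indicator (box a b) x * (indicator (cbox a b) x * g x)"
        by (intro AE_I2 tendsto_mult box_bump_tendsto_indicator tendsto_const)
    qed
    moreover have "(\<integral>x. box_bump n a b x * (indicator (cbox a b) x * g x) \<partial>lebesgue) = 0" for n
    proof -
      have "(\<integral>x. box_bump n a b x * (indicator (cbox a b) x * g x) \<partial>lebesgue) =
        (\<integral>x. indicator \<Omega> x *\<^sub>R (g x * box_bump n a b x) \<partial>lebesgue)"
        using ab box_bump_eq_0[of _ a b n] box_subset_cbox[of a b]
        by (intro Bochner_Integration.integral_cong) (auto simp: indicator_def subset_iff)
      also have "\<dots> = 0"
        using test[OF box_bump_test_function[OF ab]] \<Omega> by (simp add: integral_restrict_space)
      finally show ?thesis .
    qed
    moreover have "(\<integral>x. indicator (box a b) x * (indicator (cbox a b) x * g x) \<partial>lebesgue) =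
      (\<integral>x. indicator (box a b) x * g x \<partial>lebesgue)"
      using box_subset_cbox[of a b] by (intro Bochner_Integration.integral_cong) (auto simp: indicator_def subset_iff)
    ultimately show ?thesis
      by (simp add: LIMSEQ_const_iff)
  qed
  have ae_cbox: "AE x in lebesgue. x \<in> cbox a b \<longrightarrow> g x = 0" if ab: "cbox a b \<subseteq> \<Omega>" for a b
  proof -
    let ?f = "\<lambda>x. indicator (box a b) x * g x"
    have "integrable lebesgue (\<lambda>x. indicator (box a b) x *\<^sub>R (indicator (cbox a b) x * g x))"
      using intK[OF ab] by (intro integrable_mult_indicator) auto
    moreover have "(\<lambda>x. indicator (box a b) x *\<^sub>R (indicator (cbox a b) x * g x)) = ?f"
      using box_subset_cbox[of a b] by (auto simp: indicator_def subset_iff fun_eq_iff)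
    ultimately have "integrable lebesgue ?f"
      by simp
    moreover have "(LINT x:box c d|lebesgue. ?f x) = 0" for c d
    proof -
      obtain u v where uv: "box c d \<inter> box a b = box u v"
        unfolding box_Int_box by blast
      show ?thesis
      proof (cases "box u v = {}")
        case True
        have "(LINT x:box c d|lebesgue. ?f x) = (\<integral>x. indicator (box c d \<inter> box a b) x * g x \<partial>lebesgue)"
          unfolding set_lebesgue_integral_def by (simp add: indicator_inter_arith mult.assoc)
        then show ?thesis
          by (simp add: uv True)
      next
        case False
        \<comment> \<open>Nonemptiness matters: the closure of an empty box is empty, whereas
          \<open>cbox u v\<close> may still have points, possibly outside \<Omega>.\<close>
        then have "cbox u v \<subseteq> cbox a b"
          using uv by (metis Int_lower2 closure_box closure_mono box_eq_empty(1) inf_bot_right)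
        with ab have "cbox u v \<subseteq> \<Omega>"
          by blast
        moreover have "(LINT x:box c d|lebesgue. ?f x) = (\<integral>x. indicator (box u v) x * g x \<partial>lebesgue)"
          unfolding set_lebesgue_integral_def by (simp add: indicator_inter_arith mult.assoc flip: uv)
        ultimately show ?thesis
          using box0 by simp
      qed
    qed
    ultimately have "AE x in lebesgue. ?f x = 0"
      using box0[OF ab] by (intro AE_eq_0_if_box_integrals_eq_0)
    \<comment> \<open>The faces are negligible, so the conclusion passes to the closed box; the
      countable cover below consists of closed boxes.\<close>
    moreover have "AE x in lebesgue. x \<notin> cbox a b - box a b"
      using negligible_frontier_interval[of a b] by (intro AE_not_in) (simp add: negligible_iff_null_sets)
    ultimately show ?thesis
      by eventually_elim (auto simp: indicator_def split: if_splits)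
  qed
  obtain \<D> where D: "countable \<D>" "\<D> \<subseteq> Pow \<Omega>" "\<And>X. X \<in> \<D> \<Longrightarrow> \<exists>a b. X = cbox a b" "\<Union>\<D> = \<Omega>"
    using open_countable_Union_open_cbox[OF \<open>open \<Omega>\<close>] by blast
  have "AE x in lebesgue. x \<in> X \<longrightarrow> g x = 0" if "X \<in> \<D>" for X
    using D(2,3) that ae_cbox by blast
  then have "AE x in lebesgue. \<forall>X\<in>\<D>. x \<in> X \<longrightarrow> g x = 0"
    unfolding AE_ball_countable[OF D(1)] by blast
  then have "AE x in lebesgue. x \<in> \<Omega> \<longrightarrow> g x = 0"
    using D(4) by (auto elim!: eventually_mono)
  then show ?thesis
    using \<Omega> by (simp add: AE_restrict_space_iff)
qed

subsection \<open>Compactly supported functions and integration by parts\<close>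

text \<open>Any compact set containing the support is allowed as \<open>K\<close>, so sums and
  products need a union or a reuse of such sets and no closure of a support is ever
  computed.\<close>

definition compactly_supported :: "'a::euclidean_space set \<Rightarrow> ('a \<Rightarrow> 'b::euclidean_space) set" where
  "compactly_supported \<Omega> =
     {f. continuous_on UNIV f \<and> (\<exists>K. compact K \<and> K \<subseteq> \<Omega> \<and> (\<forall>x. x \<notin> K \<longrightarrow> f x = 0))}"

lemma integrable_lborel_compactly_supported:
  assumes "f \<in> compactly_supported \<Omega>"
  shows "integrable lborel f"
proof -
  obtain K where K: "compact K" "\<And>x. x \<notin> K \<Longrightarrow> f x = 0" and cont: "continuous_on UNIV f"
    using assms by (auto simp: compactly_supported_def)
  have "integrable lborel (\<lambda>x. indicator K x *\<^sub>R f x)"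
    using K(1) cont by (intro borel_integrable_compact) (auto intro: continuous_on_subset)
  moreover have "(\<lambda>x. indicator K x *\<^sub>R f x) = f"
    using K(2) by (auto simp: indicator_def fun_eq_iff)
  ultimately show ?thesis
    by simp
qed

lemma integrable_lebesgue_compactly_supported:
  "f \<in> compactly_supported \<Omega> \<Longrightarrow> integrable lebesgue f"
  using integrable_lborel_compactly_supported[of f \<Omega>] integrable_completion[of f lborel]
  by (auto simp: borel_measurable_integrable)

lemma integrable_lebesgue_on_compactly_supported:
  assumes "open \<Omega>" "f \<in> compactly_supported \<Omega>"
  shows "integrable (lebesgue_on \<Omega>) f"
  using assms integrable_lebesgue_compactly_supported
  by (subst integrable_restrict_space) (auto intro!: integrable_mult_indicator)

lemma integral_compactly_supported:
  assumes "open \<Omega>" and f: "f \<in> compactly_supported \<Omega>"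
  shows "integral\<^sup>L (lebesgue_on \<Omega>) f = integral\<^sup>L lborel f"
proof -
  have "integral\<^sup>L (lebesgue_on \<Omega>) f = integral\<^sup>L lebesgue (\<lambda>x. indicator \<Omega> x *\<^sub>R f x)"
    using \<open>open \<Omega>\<close> by (subst integral_restrict_space) auto
  also have "(\<lambda>x. indicator \<Omega> x *\<^sub>R f x) = f"
    using f by (auto simp: indicator_def fun_eq_iff compactly_supported_def)
  also have "integral\<^sup>L lebesgue f = integral\<^sup>L lborel f"
    using integrable_lborel_compactly_supported[OF f]
    by (intro integral_completion) (simp add: borel_measurable_integrable)
  finally show ?thesis .
qed

lemma locally_integrable_compactly_supported:
  assumes "f \<in> compactly_supported \<Omega>"
  shows "locally_integrable \<Omega> f"
  unfolding locally_integrable_def set_integrable_def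
  using integrable_lebesgue_compactly_supported[OF assms]
  by (auto intro!: integrable_mult_indicator simp: compact_imp_closed)

lemma Lp_fun_compactly_supported:
  assumes "open \<Omega>" "0 < p" and f: "f \<in> compactly_supported \<Omega>"
  shows "Lp_fun p \<Omega> f"
proof -
  have norm_f: "(\<lambda>x. norm (f x) powr p) \<in> compactly_supported \<Omega>"
    using f \<open>0 < p\<close> unfolding compactly_supported_def
    by (force intro!: continuous_on_powr' continuous_on_norm)
  then show ?thesis
    using integrable_lebesgue_on_compactly_supported[OF \<open>open \<Omega>\<close> f]
      integrable_lebesgue_on_compactly_supported[OF \<open>open \<Omega>\<close> norm_f]
    unfolding Lp_fun_def by (simp add: borel_measurable_integrable)
qed

text \<open>On \<open>K\<close> the continuous factor is bounded and off \<open>K\<close> it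
  vanishes, so a multiple of \<open>u\<close> restricted to \<open>K\<close> dominates. The pairings
  in \<open>is_weak_gradient\<close> are all of this kind, and their integrability is what lets them
  be split linearly.\<close>

lemma integrable_locally_integrable_mult:
  fixes u f :: "'a::euclidean_space \<Rightarrow> real"
  assumes "open \<Omega>" and u: "locally_integrable \<Omega> u" and f: "f \<in> compactly_supported \<Omega>"
  shows "integrable (lebesgue_on \<Omega>) (\<lambda>x. u x * f x)"
proof -
  obtain K where K: "compact K" "K \<subseteq> \<Omega>" "\<And>x. x \<notin> K \<Longrightarrow> f x = 0" and cont: "continuous_on UNIV f"
    using f by (auto simp: compactly_supported_def)
  have "compact (f ` K)"
    using K(1) cont by (intro compact_continuous_image) (auto intro: continuous_on_subset)
  then have "\<exists>B. \<forall>x\<in>K. \<bar>f x\<bar> \<le> B"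
    by (auto dest!: compact_imp_bounded simp: bounded_iff)
  then obtain B where B: "\<And>x. x \<in> K \<Longrightarrow> \<bar>f x\<bar> \<le> B"
    by blast
  have uK: "integrable lebesgue (\<lambda>x. indicator K x *\<^sub>R u x)"
    using u K by (auto simp: locally_integrable_def set_integrable_def)
  have "integrable lebesgue (\<lambda>x. (indicator K x *\<^sub>R u x) * f x)"
  proof (rule Bochner_Integration.integrable_bound)
    show "integrable lebesgue (\<lambda>x. B * (indicator K x *\<^sub>R u x))"
      using uK by (rule integrable_mult_right)
    show "(\<lambda>x. (indicator K x *\<^sub>R u x) * f x) \<in> borel_measurable lebesgue"
      by (rule borel_measurable_times[OF borel_measurable_integrable[OF uK]
            borel_measurable_integrable[OF integrable_lebesgue_compactly_supported[OF f]]])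
    show "AE x in lebesgue. norm ((indicator K x *\<^sub>R u x) * f x) \<le> norm (B * (indicator K x *\<^sub>R u x))"
    proof (rule AE_I2)
      fix x
      show "norm ((indicator K x *\<^sub>R u x) * f x) \<le> norm (B * (indicator K x *\<^sub>R u x))"
        using order_trans[OF B[of x] abs_ge_self]
        by (cases "x \<in> K") (auto simp: abs_mult mult.commute intro!: mult_right_mono)
    qed
  qed
  also have "(\<lambda>x. (indicator K x *\<^sub>R u x) * f x) = (\<lambda>x. indicator \<Omega> x *\<^sub>R (u x * f x))"
    using K by (auto simp: indicator_def fun_eq_iff)
  finally show ?thesis
    using \<open>open \<Omega>\<close> by (subst integrable_restrict_space) auto
qed

section \<open>Integrals of partial derivatives\<close>

lemma has_derivative_line:
  fixes f :: "'a::euclidean_space \<Rightarrow> real"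
  assumes "f differentiable_on UNIV"
  shows "((\<lambda>t. f (x + t *\<^sub>R b)) has_real_derivative partial_deriv b f (x + t *\<^sub>R b)) (at t within S)"
proof -
  have d: "(f has_derivative frechet_derivative f (at (x + t *\<^sub>R b))) (at (x + t *\<^sub>R b))"
    using assms by (simp add: frechet_derivative_works[symmetric] differentiable_on_def)
  have l: "((\<lambda>t. x + t *\<^sub>R b) has_derivative (\<lambda>h. h *\<^sub>R b)) (at t within S)"
    by (auto intro!: derivative_eq_intros)
  have "((\<lambda>t. f (x + t *\<^sub>R b)) has_derivative (\<lambda>h. frechet_derivative f (at (x + t *\<^sub>R b)) (h *\<^sub>R b))) (at t within S)"
    using has_derivative_compose[OF l d] .
  moreover have "(\<lambda>h. frechet_derivative f (at (x + t *\<^sub>R b)) (h *\<^sub>R b)) =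
      (*) (partial_deriv b f (x + t *\<^sub>R b))"
    using linear_scale[OF has_derivative_linear[OF d]]
    by (auto simp: partial_deriv_def mult.commute)
  ultimately show ?thesis
    by (simp add: has_field_derivative_def)
qed

text \<open>By translation invariance all difference quotients of \<open>f\<close> have integral \<open>0\<close>.\<close>

lemma integral_partial_deriv_eq_0:
  fixes f :: "'a::euclidean_space \<Rightarrow> real"
  assumes diff: "f differentiable_on UNIV" and f: "f \<in> compactly_supported UNIV"
    and df: "partial_deriv b f \<in> compactly_supported UNIV"
  shows "integral\<^sup>L lborel (partial_deriv b f) = 0"
proof -
  define Q where "Q n x = (f (x + (1 / real (Suc n)) *\<^sub>R b) - f x) / (1 / real (Suc n))" for n :: nat and x
  have fint: "integrable lborel f"
    using f by (rule integrable_lborel_compactly_supported)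
  have shift: "integrable lborel (\<lambda>x. f (x + c)) \<and> integral\<^sup>L lborel (\<lambda>x. f (x + c)) = integral\<^sup>L lborel f" for c
  proof -
    have m: "f \<in> borel_measurable borel"
      using fint by (simp add: borel_measurable_integrable)
    have "integrable (distr lborel borel ((+) c)) f"
      using fint by (simp add: lborel_distr_plus)
    then have "integrable lborel (\<lambda>x. f (c + x))"
      using m by (subst (asm) integrable_distr_eq) auto
    moreover have "integral\<^sup>L (distr lborel borel ((+) c)) f = integral\<^sup>L lborel (\<lambda>x. f (c + x))"
      using m by (subst integral_distr) auto
    ultimately show ?thesis
      by (simp add: lborel_distr_plus add.commute)
  qed
  obtain K where K: "compact K" "\<And>x. x \<notin> K \<Longrightarrow> f x = 0"
    using f by (auto simp: compactly_supported_def)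
  obtain K' where K': "compact K'" "\<And>x. x \<notin> K' \<Longrightarrow> partial_deriv b f x = 0" and cont: "continuous_on UNIV (partial_deriv b f)"
    using df by (auto simp: compactly_supported_def)
  have "compact (partial_deriv b f ` K')"
    using K'(1) cont by (intro compact_continuous_image) (auto intro: continuous_on_subset)
  then have "\<exists>B. \<forall>x\<in>K'. \<bar>partial_deriv b f x\<bar> \<le> B"
    by (auto dest!: compact_imp_bounded simp: bounded_iff)
  then obtain B where "\<And>x. x \<in> K' \<Longrightarrow> \<bar>partial_deriv b f x\<bar> \<le> B"
    by blast
  \<comment> \<open>\<open>K'\<close> may be empty, and then nothing forces \<open>B\<close> to be
    nonnegative.\<close>
  then have B: "\<bar>partial_deriv b f x\<bar> \<le> max B 0" for x
    using K'(2)[of x] by (cases "x \<in> K'") (auto simp: max.coboundedI1)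
  obtain R where R: "\<And>x. x \<in> K \<Longrightarrow> norm x \<le> R"
    using compact_imp_bounded[OF K(1)] by (auto simp: bounded_iff)
  \<comment> \<open>The domination for the limit: the steps are at most 1, so all quotients vanish
    outside one ball, the support enlarged by \<open>norm b\<close>; inside it the mean value
    theorem turns a quotient into a value of the derivative.\<close>
  have Qle: "\<bar>Q n x\<bar> \<le> max B 0 * indicator (cball 0 (R + norm b)) x" for n x
  proof (cases "x \<in> cball 0 (R + norm b)")
    case True
    have "\<exists>t. 0 < t \<and> t < 1 / real (Suc n) \<and> f (x + (1 / real (Suc n)) *\<^sub>R b) - f (x + 0 *\<^sub>R b)
        = (1 / real (Suc n) - 0) * partial_deriv b f (x + t *\<^sub>R b)"
      by (rule MVT2) (use has_derivative_line[OF diff] in auto)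
    then obtain t where "f (x + (1 / real (Suc n)) *\<^sub>R b) - f x = (1 / real (Suc n)) * partial_deriv b f (x + t *\<^sub>R b)"
      by auto
    then have "Q n x = partial_deriv b f (x + t *\<^sub>R b)"
      by (simp add: Q_def)
    then show ?thesis
      using True B by simp
  next
    case False
    have "norm x \<le> norm (x + (1 / real (Suc n)) *\<^sub>R b) + norm ((1 / real (Suc n)) *\<^sub>R b)"
      by (metis add_diff_cancel_right' norm_triangle_ineq4)
    moreover have "norm ((1 / real (Suc n)) *\<^sub>R b) \<le> norm b"
      by (simp add: divide_le_eq mult_le_cancel_left1)
    ultimately have "x \<notin> K" "x + (1 / real (Suc n)) *\<^sub>R b \<notin> K"
      using False R[of x] R[of "x + (1 / real (Suc n)) *\<^sub>R b"] norm_ge_zero[of b]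
      unfolding mem_cball_0 by linarith+
    then show ?thesis
      using False K(2) by (simp add: Q_def)
  qed
  have "(\<lambda>n. integral\<^sup>L lborel (Q n)) \<longlonglongrightarrow> integral\<^sup>L lborel (partial_deriv b f)"
  proof (rule integral_dominated_convergence)
    show "integrable lborel (\<lambda>x. max B 0 * indicator (cball 0 (R + norm b)) x)"
      by (intro integrable_mult_right integrable_real_indicator emeasure_bounded_finite) auto
    show "partial_deriv b f \<in> borel_measurable lborel"
      using cont by (simp add: borel_measurable_continuous_onI)
    show "Q n \<in> borel_measurable lborel" for n
      using shift fint unfolding Q_def[abs_def] by (intro borel_measurable_integrable) auto
    show "AE x in lborel. (\<lambda>n. Q n x) \<longlonglongrightarrow> partial_deriv b f x"
    proof (rule AE_I2)
      fix x
      have "((\<lambda>h. (f (x + h *\<^sub>R b) - f x) / h) \<longlongrightarrow> partial_deriv b f x) (at 0)"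
        using has_derivative_line[OF diff, of x b 0 UNIV] by (simp add: has_field_derivative_iff)
      moreover have "filterlim (\<lambda>n. 1 / real (Suc n)) (at 0) sequentially"
        by (intro filterlim_atI LIMSEQ_Suc lim_1_over_n) auto
      ultimately show "(\<lambda>n. Q n x) \<longlonglongrightarrow> partial_deriv b f x"
        unfolding Q_def by (rule filterlim_compose)
    qed
    show "AE x in lborel. norm (Q n x) \<le> max B 0 * indicator (cball 0 (R + norm b)) x" for n
      using Qle by simp
  qed
  moreover have "integral\<^sup>L lborel (Q n) = 0" for n
    unfolding Q_def[abs_def] using shift fint by (simp only: integral_divide_zero Bochner_Integration.integral_diff) simp
  ultimately show ?thesis
    by (simp add: LIMSEQ_const_iff)
qed

section \<open>Test functions and their calculus\<close>

lemma partial_deriv_lincomb: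
  assumes "f differentiable (at x)" "g differentiable (at x)"
  shows "partial_deriv b (\<lambda>x. c * f x + d * g x) x = c * partial_deriv b f x + d * partial_deriv b g x"
proof -
  have "(f has_derivative frechet_derivative f (at x)) (at x)"
    "(g has_derivative frechet_derivative g (at x)) (at x)"
    using assms by (simp_all add: frechet_derivative_works[symmetric])
  from has_derivative_add[OF has_derivative_mult_right[OF this(1), of c] has_derivative_mult_right[OF this(2), of d]]
  show ?thesis
    by (simp add: partial_deriv_eqI) (simp add: partial_deriv_def)
qed

lemma smooth_fun_lincomb:
  assumes "smooth_fun f" "smooth_fun g"
  shows "smooth_fun (\<lambda>x. c * f x + d * g x)"
proof -
  have "iter_partial bs (\<lambda>x. c * f x + d * g x) = (\<lambda>x. c * iter_partial bs f x + d * iter_partial bs g x)"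
    if "bs \<in> lists Basis" for bs
    using that
  proof (induction bs)
    case (Cons b bs)
    then have "iter_partial bs f differentiable_on UNIV" "iter_partial bs g differentiable_on UNIV"
      using assms by (auto simp: smooth_fun_def)
    moreover have "iter_partial bs (\<lambda>x. c * f x + d * g x) = (\<lambda>x. c * iter_partial bs f x + d * iter_partial bs g x)"
      using Cons by auto
    ultimately show ?case
      by (auto simp only: iter_partial.simps differentiable_on_def intro!: ext partial_deriv_lincomb)
  qed simp
  then show ?thesis
    using assms by (auto simp: smooth_fun_def intro!: derivative_intros)
qed

lemma test_functions_lincomb:
  assumes "\<phi> \<in> test_functions \<Omega>" "\<psi> \<in> test_functions \<Omega>"
  shows "(\<lambda>x. c * \<phi> x + d * \<psi> x) \<in> test_functions \<Omega>"
proof -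
  let ?K = "closure {x. \<phi> x \<noteq> 0} \<union> closure {x. \<psi> x \<noteq> 0}"
  have K: "compact ?K" "?K \<subseteq> \<Omega>"
    using assms by (auto simp: test_functions_def)
  have sub: "closure {x. c * \<phi> x + d * \<psi> x \<noteq> 0} \<subseteq> ?K"
  proof (rule closure_minimal)
    have "{x. c * \<phi> x + d * \<psi> x \<noteq> 0} \<subseteq> {x. \<phi> x \<noteq> 0} \<union> {x. \<psi> x \<noteq> 0}"
      by auto
    then show "{x. c * \<phi> x + d * \<psi> x \<noteq> 0} \<subseteq> ?K"
      using closure_subset[of "{x. \<phi> x \<noteq> 0}"] closure_subset[of "{x. \<psi> x \<noteq> 0}"] by blast
  qed (intro closed_Un closed_closure)
  then have "compact (closure {x. c * \<phi> x + d * \<psi> x \<noteq> 0})"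
    using compact_imp_bounded[OF K(1)] bounded_subset closed_closure compact_eq_bounded_closed by blast
  then show ?thesis
    using order_trans[OF sub K(2)] assms by (simp add: test_functions_def smooth_fun_lincomb)
qed

lemma test_functionD:
  assumes "\<phi> \<in> test_functions \<Omega>"
  shows "\<phi> differentiable_on UNIV" and "\<phi> \<in> compactly_supported \<Omega>"
    and "b \<in> Basis \<Longrightarrow> partial_deriv b \<phi> \<in> compactly_supported \<Omega>"
proof -
  let ?K = "closure {x. \<phi> x \<noteq> 0}"
  have K: "compact ?K" "?K \<subseteq> \<Omega>" and sm: "smooth_fun \<phi>"
    using assms by (auto simp: test_functions_def)
  have "iter_partial [] \<phi> differentiable_on UNIV"
    using sm by (simp only: smooth_fun_def lists.Nil)
  then show diff: "\<phi> differentiable_on UNIV"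
    by simp
  have out: "\<phi> x = 0" if "x \<notin> ?K" for x
    using that closure_subset[of "{x. \<phi> x \<noteq> 0}"] by blast
  show "\<phi> \<in> compactly_supported \<Omega>"
    unfolding compactly_supported_def
    by (intro CollectI conjI exI[of _ ?K] allI impI K out differentiable_imp_continuous_on[OF diff])
  assume b: "b \<in> Basis"
  have "iter_partial [b] \<phi> differentiable_on UNIV"
    using sm b by (simp only: smooth_fun_def lists.Nil lists.Cons)
  then have cont: "continuous_on UNIV (partial_deriv b \<phi>)"
    by (simp add: differentiable_imp_continuous_on)
  have out': "partial_deriv b \<phi> x = 0" if "x \<notin> ?K" for x
  proof -
    have "(\<phi> has_derivative (\<lambda>_. 0)) (at x)"
    proof (rule has_derivative_transform_within_open)
      show "((\<lambda>_. 0) has_derivative (\<lambda>_. 0)) (at x)"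
        by (rule has_derivative_const)
      show "open (- ?K)" "x \<in> - ?K"
        using that by (simp_all only: open_Compl closed_closure Compl_iff not_False_eq_True)
      show "0 = \<phi> y" if "y \<in> - ?K" for y
        by (rule out[symmetric]) (use that in \<open>simp only: Compl_iff not_False_eq_True\<close>)
    qed
    then show ?thesis
      by (rule partial_deriv_eqI)
  qed
  show "partial_deriv b \<phi> \<in> compactly_supported \<Omega>"
    unfolding compactly_supported_def
    by (intro CollectI conjI exI[of _ ?K] allI impI K out' cont)
qed

lemma compactly_supported_mono: "\<Omega> \<subseteq> \<Omega>' \<Longrightarrow> f \<in> compactly_supported \<Omega> \<Longrightarrow> f \<in> compactly_supported \<Omega>'"
  by (auto simp: compactly_supported_def)

lemma compactly_supported_mult:
  fixes f g :: "'a::euclidean_space \<Rightarrow> real"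
  assumes "f \<in> compactly_supported \<Omega>" "g \<in> compactly_supported \<Omega>"
  shows "(\<lambda>x. f x * g x) \<in> compactly_supported \<Omega>"
  using assms by (force simp: compactly_supported_def intro: continuous_on_mult)

lemma compactly_supported_add:
  assumes "f \<in> compactly_supported \<Omega>" "g \<in> compactly_supported \<Omega>"
  shows "(\<lambda>x. f x + g x) \<in> compactly_supported \<Omega>"
proof -
  obtain K L where "compact K" "compact L" "K \<subseteq> \<Omega>" "L \<subseteq> \<Omega>"
    "\<forall>x. x \<notin> K \<longrightarrow> f x = 0" "\<forall>x. x \<notin> L \<longrightarrow> g x = 0"
    using assms unfolding compactly_supported_def by blast
  then have "compact (K \<union> L) \<and> K \<union> L \<subseteq> \<Omega> \<and> (\<forall>x. x \<notin> K \<union> L \<longrightarrow> f x + g x = 0)"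
    by auto
  then show ?thesis
    using assms unfolding compactly_supported_def by (blast intro: continuous_on_add)
qed

text \<open>By the product rule the two integrands add up to the partial derivative of a compactly
  supported function, whose integral is 0.\<close>

lemma integration_by_parts_test_functions:
  assumes "open \<Omega>" and \<phi>: "\<phi> \<in> test_functions \<Omega>" and \<psi>: "\<psi> \<in> test_functions \<Omega>" and b: "b \<in> Basis"
  shows "(LINT x|lebesgue_on \<Omega>. \<phi> x * partial_deriv b \<psi> x) = - (LINT x|lebesgue_on \<Omega>. partial_deriv b \<phi> x * \<psi> x)"
proof -
  have pd: "partial_deriv b (\<lambda>x. \<phi> x * \<psi> x) = (\<lambda>x. \<phi> x * partial_deriv b \<psi> x + partial_deriv b \<phi> x * \<psi> x)"
  proof
    fix x
    have "(\<phi> has_derivative frechet_derivative \<phi> (at x)) (at x)"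
      "(\<psi> has_derivative frechet_derivative \<psi> (at x)) (at x)"
      using test_functionD(1)[OF \<phi>] test_functionD(1)[OF \<psi>]
      by (simp_all add: frechet_derivative_works[symmetric] differentiable_on_def)
    from has_derivative_mult[OF this]
    show "partial_deriv b (\<lambda>x. \<phi> x * \<psi> x) x = \<phi> x * partial_deriv b \<psi> x + partial_deriv b \<phi> x * \<psi> x"
      by (simp add: partial_deriv_eqI) (simp add: partial_deriv_def)
  qed
  have c1: "(\<lambda>x. \<phi> x * partial_deriv b \<psi> x) \<in> compactly_supported \<Omega>"
    and c2: "(\<lambda>x. partial_deriv b \<phi> x * \<psi> x) \<in> compactly_supported \<Omega>"
    and c3: "(\<lambda>x. \<phi> x * \<psi> x) \<in> compactly_supported \<Omega>"
    using \<phi> \<psi> b by (simp_all add: compactly_supported_mult test_functionD(2,3))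
  have "partial_deriv b (\<lambda>x. \<phi> x * \<psi> x) \<in> compactly_supported UNIV"
    unfolding pd using compactly_supported_add[OF c1 c2] by (rule compactly_supported_mono[OF subset_UNIV])
  then have "integral\<^sup>L lborel (partial_deriv b (\<lambda>x. \<phi> x * \<psi> x)) = 0"
    using c3 compactly_supported_mono[of \<Omega> UNIV] test_functionD(1)[OF \<phi>] test_functionD(1)[OF \<psi>]
    by (intro integral_partial_deriv_eq_0 differentiable_on_mult) auto
  then have "integral\<^sup>L lborel (\<lambda>x. \<phi> x * partial_deriv b \<psi> x) + integral\<^sup>L lborel (\<lambda>x. partial_deriv b \<phi> x * \<psi> x) = 0"
    unfolding pd
    by (subst Bochner_Integration.integral_add[symmetric]) (auto intro: integrable_lborel_compactly_supported c1 c2)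
  then show ?thesis
    using integral_compactly_supported[OF \<open>open \<Omega>\<close> c1] integral_compactly_supported[OF \<open>open \<Omega>\<close> c2] by simp
qed

subsection \<open>Weak gradients\<close>

lemma locally_integrable_lincomb:
  fixes u v :: "'a::euclidean_space \<Rightarrow> 'b::euclidean_space"
  assumes "locally_integrable \<Omega> u" "locally_integrable \<Omega> v"
  shows "locally_integrable \<Omega> (\<lambda>x. c *\<^sub>R u x + d *\<^sub>R v x)"
  using assms unfolding locally_integrable_def
  by (simp add: set_integral_add(1) set_integrable_scaleR_right)

lemma locally_integrable_inner:
  fixes u :: "'a::euclidean_space \<Rightarrow> 'b::euclidean_space"
  assumes "locally_integrable \<Omega> u"
  shows "locally_integrable \<Omega> (\<lambda>x. u x \<bullet> b)"
  unfolding locally_integrable_def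
proof (intro allI impI)
  fix K assume "compact K \<and> K \<subseteq> \<Omega>"
  then have "integrable lebesgue (\<lambda>x. (indicator K x *\<^sub>R u x) \<bullet> b)"
    using assms by (intro integrable_inner_left) (auto simp: locally_integrable_def set_integrable_def)
  then show "set_integrable lebesgue K (\<lambda>x. u x \<bullet> b)"
    by (simp add: set_integrable_def)
qed

text \<open>Local integrability gives measurability on compact sets only; gluing over a countable
  cover of \<Omega> by closed boxes makes it global. Weak gradients get their measurability from
  here.\<close>

lemma borel_measurable_locally_integrable:
  fixes u :: "'a::euclidean_space \<Rightarrow> 'b::euclidean_space"
  assumes "open \<Omega>" and u: "locally_integrable \<Omega> u"
  shows "u \<in> borel_measurable (lebesgue_on \<Omega>)"
proof -
  obtain \<D> where D: "countable \<D>" "\<D> \<subseteq> Pow \<Omega>" "\<And>X. X \<in> \<D> \<Longrightarrow> \<exists>a b. X = cbox a b" "\<Union>\<D> = \<Omega>"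
    using open_countable_Union_open_cbox[OF \<open>open \<Omega>\<close>] by blast
  have cl: "compact X" "X \<subseteq> \<Omega>" if "X \<in> \<D>" for X
    using D(2) D(3)[OF that] that by auto
  show ?thesis
  proof (rule measurable_piecewise_restrict[OF D(1)])
    fix X assume X: "X \<in> \<D>"
    have L: "X \<in> sets lebesgue"
      using cl[OF X] by (auto simp: compact_imp_closed)
    then show "X \<inter> space (lebesgue_on \<Omega>) \<in> sets (lebesgue_on \<Omega>)"
      using cl(2)[OF X] \<open>open \<Omega>\<close> by (subst sets_restrict_space_iff) (auto simp: Int_absorb2)
    have "(\<lambda>x. indicator X x *\<^sub>R u x) \<in> borel_measurable lebesgue"
      using u cl[OF X] by (auto simp: locally_integrable_def set_integrable_def)
    then have "u \<in> borel_measurable (lebesgue_on X)"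
      using L by (subst borel_measurable_restrict_space_iff) auto
    then show "u \<in> borel_measurable (restrict_space (lebesgue_on \<Omega>) X)"
      using L \<open>open \<Omega>\<close> cl(2)[OF X] by (subst restrict_restrict_space) (auto simp: Int_absorb1)
  qed (use D(4) in auto)
qed

lemma locally_integrable_cong_AE:
  fixes u v :: "'a::euclidean_space \<Rightarrow> 'b::euclidean_space"
  assumes "open \<Omega>" and u: "locally_integrable \<Omega> u" and v: "v \<in> borel_measurable (lebesgue_on \<Omega>)"
    and ae: "AE x in lebesgue_on \<Omega>. v x = u x"
  shows "locally_integrable \<Omega> v"
  unfolding locally_integrable_def set_integrable_def
proof (intro allI impI)
  fix K assume K: "compact K \<and> K \<subseteq> \<Omega>"
  have m\<Omega>: "(\<lambda>x. indicator \<Omega> x *\<^sub>R v x) \<in> borel_measurable lebesgue"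
    using v \<open>open \<Omega>\<close> by (subst borel_measurable_restrict_space_iff[symmetric]) auto
  have "(\<lambda>x. indicator K x *\<^sub>R (indicator \<Omega> x *\<^sub>R v x)) \<in> borel_measurable lebesgue"
    by (rule borel_measurable_scaleR[OF borel_measurable_indicator m\<Omega>]) (use K in \<open>auto simp: compact_imp_closed\<close>)
  also have "(\<lambda>x. indicator K x *\<^sub>R (indicator \<Omega> x *\<^sub>R v x)) = (\<lambda>x. indicator K x *\<^sub>R v x)"
    using K by (auto simp: indicator_def fun_eq_iff)
  finally have mv: "(\<lambda>x. indicator K x *\<^sub>R v x) \<in> borel_measurable lebesgue" .
  have iu: "integrable lebesgue (\<lambda>x. indicator K x *\<^sub>R u x)"
    using u K by (auto simp: locally_integrable_def set_integrable_def)
  have "AE x in lebesgue. x \<in> \<Omega> \<longrightarrow> v x = u x"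
    using ae \<open>open \<Omega>\<close> by (subst (asm) AE_restrict_space_iff) auto
  then have "AE x in lebesgue. indicator K x *\<^sub>R u x = indicator K x *\<^sub>R v x"
    by eventually_elim (use K in \<open>auto simp: indicator_def\<close>)
  then show "integrable lebesgue (\<lambda>x. indicator K x *\<^sub>R v x)"
    using iu integrable_cong_AE_imp mv by (metis (no_types, lifting) AE_cong)
qed

locale open_domain =
  fixes \<Omega> :: "'a::euclidean_space set"
  assumes open_domain: "open \<Omega>"
begin

lemma is_weak_gradient_integrable:
  assumes "is_weak_gradient \<Omega> u g" "\<phi> \<in> test_functions \<Omega>" "b \<in> Basis"
  shows "integrable (lebesgue_on \<Omega>) (\<lambda>x. u x * partial_deriv b \<phi> x)"
    and "integrable (lebesgue_on \<Omega>) (\<lambda>x. (g x \<bullet> b) * \<phi> x)"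
  using assms integrable_locally_integrable_mult[OF open_domain] test_functionD(2,3)[OF assms(2)]
    locally_integrable_inner[of \<Omega> g b]
  unfolding is_weak_gradient_def by blast+

lemma is_weak_gradient_lincomb:
  assumes u: "is_weak_gradient \<Omega> u g" and v: "is_weak_gradient \<Omega> v h"
  shows "is_weak_gradient \<Omega> (\<lambda>x. c * u x + d * v x) (\<lambda>x. c *\<^sub>R g x + d *\<^sub>R h x)"
  unfolding is_weak_gradient_def
proof (intro conjI ballI)
  show "locally_integrable \<Omega> (\<lambda>x. c * u x + d * v x)"
    using u v locally_integrable_lincomb[of \<Omega> u v c d] by (simp add: is_weak_gradient_def)
  show "locally_integrable \<Omega> (\<lambda>x. c *\<^sub>R g x + d *\<^sub>R h x)"
    using u v by (simp add: is_weak_gradient_def locally_integrable_lincomb)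
  fix \<phi> and b :: 'a
  assume \<phi>: "\<phi> \<in> test_functions \<Omega>" and b: "b \<in> Basis"
  note int = is_weak_gradient_integrable[OF u \<phi> b] is_weak_gradient_integrable[OF v \<phi> b]
  have "(LINT x|lebesgue_on \<Omega>. (c * u x + d * v x) * partial_deriv b \<phi> x) =
      (LINT x|lebesgue_on \<Omega>. c * (u x * partial_deriv b \<phi> x) + d * (v x * partial_deriv b \<phi> x))"
    by (simp add: algebra_simps)
  also have "\<dots> = c * (LINT x|lebesgue_on \<Omega>. u x * partial_deriv b \<phi> x) + d * (LINT x|lebesgue_on \<Omega>. v x * partial_deriv b \<phi> x)"
    using int by simp
  also have "\<dots> = - (c * (LINT x|lebesgue_on \<Omega>. (g x \<bullet> b) * \<phi> x) + d * (LINT x|lebesgue_on \<Omega>. (h x \<bullet> b) * \<phi> x))"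
    using u v \<phi> b by (simp add: is_weak_gradient_def)
  also have "\<dots> = - (LINT x|lebesgue_on \<Omega>. c * ((g x \<bullet> b) * \<phi> x) + d * ((h x \<bullet> b) * \<phi> x))"
    using int by simp
  also have "\<dots> = - (LINT x|lebesgue_on \<Omega>. ((c *\<^sub>R g x + d *\<^sub>R h x) \<bullet> b) * \<phi> x)"
    by (simp add: algebra_simps)
  finally show "(LINT x|lebesgue_on \<Omega>. (c * u x + d * v x) * partial_deriv b \<phi> x) =
      - (LINT x|lebesgue_on \<Omega>. ((c *\<^sub>R g x + d *\<^sub>R h x) \<bullet> b) * \<phi> x)" .
qed

lemma is_weak_gradient_cong_AE:
  assumes u: "is_weak_gradient \<Omega> u g" and v: "v \<in> borel_measurable (lebesgue_on \<Omega>)"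
    and ae: "AE x in lebesgue_on \<Omega>. v x = u x"
  shows "is_weak_gradient \<Omega> v g"
  unfolding is_weak_gradient_def
proof (intro conjI ballI)
  show lv: "locally_integrable \<Omega> v"
    using u by (intro locally_integrable_cong_AE[OF open_domain _ v ae]) (simp add: is_weak_gradient_def)
  show "locally_integrable \<Omega> g"
    using u by (simp add: is_weak_gradient_def)
  fix \<phi> and b :: 'a
  assume \<phi>: "\<phi> \<in> test_functions \<Omega>" and b: "b \<in> Basis"
  have "integrable (lebesgue_on \<Omega>) (\<lambda>x. v x * partial_deriv b \<phi> x)"
    using lv \<phi> b by (intro integrable_locally_integrable_mult open_domain test_functionD)
  then have "(LINT x|lebesgue_on \<Omega>. v x * partial_deriv b \<phi> x) = (LINT x|lebesgue_on \<Omega>. u x * partial_deriv b \<phi> x)"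
    using is_weak_gradient_integrable(1)[OF u \<phi> b] ae by (intro integral_cong_AE) auto
  then show "(LINT x|lebesgue_on \<Omega>. v x * partial_deriv b \<phi> x) = - (LINT x|lebesgue_on \<Omega>. (g x \<bullet> b) * \<phi> x)"
    using u \<phi> b by (simp add: is_weak_gradient_def)
qed

text \<open>As \<open>u\<close> and \<open>v\<close> agree almost everywhere, both \<open>g\<close>
  and \<open>h\<close> are weak gradients of \<open>v\<close>, so every test function annihilates
  each component of their difference. This is what makes the choice in \<open>weak_grad\<close>
  harmless.\<close>

lemma is_weak_gradient_unique:
  assumes u: "is_weak_gradient \<Omega> u g" and v: "is_weak_gradient \<Omega> v h"
    and ae: "AE x in lebesgue_on \<Omega>. v x = u x"
  shows "AE x in lebesgue_on \<Omega>. h x = g x"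
proof -
  have "v \<in> borel_measurable (lebesgue_on \<Omega>)"
    using v by (intro borel_measurable_locally_integrable open_domain) (simp add: is_weak_gradient_def)
  then have v': "is_weak_gradient \<Omega> v g"
    using is_weak_gradient_cong_AE[OF u _ ae] by blast
  have "AE x in lebesgue_on \<Omega>. (h x - g x) \<bullet> b = 0" if b: "b \<in> Basis" for b
  proof (rule fundamental_lemma_calculus_of_variations[OF open_domain])
    have "locally_integrable \<Omega> (\<lambda>x. 1 *\<^sub>R h x + (- 1) *\<^sub>R g x)"
      using u v unfolding is_weak_gradient_def by (intro locally_integrable_lincomb) auto
    then show "locally_integrable \<Omega> (\<lambda>x. (h x - g x) \<bullet> b)"
      by (intro locally_integrable_inner) simp
    fix \<phi> assume \<phi>: "\<phi> \<in> test_functions \<Omega>"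
    have "(LINT x|lebesgue_on \<Omega>. (h x - g x) \<bullet> b * \<phi> x) =
        (LINT x|lebesgue_on \<Omega>. h x \<bullet> b * \<phi> x - g x \<bullet> b * \<phi> x)"
      by (simp add: inner_diff_left left_diff_distrib)
    also have "\<dots> = (LINT x|lebesgue_on \<Omega>. h x \<bullet> b * \<phi> x) - (LINT x|lebesgue_on \<Omega>. g x \<bullet> b * \<phi> x)"
      using is_weak_gradient_integrable(2)[OF u \<phi> b] is_weak_gradient_integrable(2)[OF v \<phi> b] by simp
    also have "\<dots> = 0"
    proof -
      have "- (LINT x|lebesgue_on \<Omega>. h x \<bullet> b * \<phi> x) = - (LINT x|lebesgue_on \<Omega>. g x \<bullet> b * \<phi> x)"
        using v v' \<phi> b unfolding is_weak_gradient_def by metis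
      then show ?thesis
        by simp
    qed
    finally show "(LINT x|lebesgue_on \<Omega>. (h x - g x) \<bullet> b * \<phi> x) = 0" .
  qed
  then have "AE x in lebesgue_on \<Omega>. \<forall>b\<in>Basis. (h x - g x) \<bullet> b = 0"
    by (subst AE_ball_countable) (auto intro: countable_finite)
  then show ?thesis
    by eventually_elim (subst euclidean_eq_iff, simp add: inner_diff_left)
qed

end

subsection \<open>Sobolev functions and their norm\<close>

lemma (in homogeneous_gauge) minkowski_lincomb:
  assumes "integrable M (\<lambda>x. q (F x))" and "integrable M (\<lambda>x. q (G x))"
  shows "(LINT x|M. q (c *\<^sub>R F x + d *\<^sub>R G x)) powr (1 / p) \<le>
    \<bar>c\<bar> * (LINT x|M. q (F x)) powr (1 / p) + \<bar>d\<bar> * (LINT x|M. q (G x)) powr (1 / p)"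
proof -
  have "integrable M (\<lambda>x. q (c *\<^sub>R F x))" "integrable M (\<lambda>x. q (d *\<^sub>R G x))"
    using assms by (simp_all add: homogeneous)
  from minkowski[OF this] show ?thesis
    by (simp only: integral_scale)
qed

definition Lp_norm :: "real \<Rightarrow> 'a::euclidean_space set \<Rightarrow> ('a \<Rightarrow> 'b::euclidean_space) \<Rightarrow> real" where
  "Lp_norm p \<Omega> u = (LINT x|lebesgue_on \<Omega>. norm (u x) powr p) powr (1 / p)"

locale sobolev = open_domain \<Omega> for \<Omega> :: "'a::euclidean_space set" +
  fixes p :: real
  assumes p_ge_1: "1 \<le> p"
begin

sublocale norm_gauge: homogeneous_gauge "\<lambda>y::'b::euclidean_space. norm y powr p" p
  by (rule homogeneous_gauge_norm[OF p_ge_1])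

sublocale pair_gauge: homogeneous_gauge "\<lambda>z::real \<times> 'a. norm (fst z) powr p + norm (snd z) powr p" p
  by (intro homogeneous_gauge_prod homogeneous_gauge_norm p_ge_1)

section \<open>The seminorm of \<open>L^p\<close>\<close>

lemma Lp_fun_lincomb:
  fixes u v :: "'a \<Rightarrow> 'b::euclidean_space"
  assumes u: "Lp_fun p \<Omega> u" and v: "Lp_fun p \<Omega> v"
  shows "Lp_fun p \<Omega> (\<lambda>x. c *\<^sub>R u x + d *\<^sub>R v x)"
proof -
  have [measurable]: "u \<in> borel_measurable (lebesgue_on \<Omega>)" "v \<in> borel_measurable (lebesgue_on \<Omega>)"
    using u v by (auto simp: Lp_fun_def)
  have "integrable (lebesgue_on \<Omega>) (\<lambda>x. norm (c *\<^sub>R u x + d *\<^sub>R v x) powr p)"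
  proof (rule Bochner_Integration.integrable_bound)
    show "integrable (lebesgue_on \<Omega>) (\<lambda>x. 2 powr p * (\<bar>c\<bar> powr p * norm (u x) powr p + \<bar>d\<bar> powr p * norm (v x) powr p))"
      using u v by (auto simp: Lp_fun_def)
    show "AE x in lebesgue_on \<Omega>. norm (norm (c *\<^sub>R u x + d *\<^sub>R v x) powr p) \<le>
        norm (2 powr p * (\<bar>c\<bar> powr p * norm (u x) powr p + \<bar>d\<bar> powr p * norm (v x) powr p))"
    proof (rule AE_I2)
      fix x
      show "norm (norm (c *\<^sub>R u x + d *\<^sub>R v x) powr p) \<le>
        norm (2 powr p * (\<bar>c\<bar> powr p * norm (u x) powr p + \<bar>d\<bar> powr p * norm (v x) powr p))"
        using norm_gauge.add_le[of "c *\<^sub>R u x" "d *\<^sub>R v x"] unfolding norm_gauge.homogeneous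
        by simp
    qed
  qed measurable
  then show ?thesis
    by (simp add: Lp_fun_def)
qed

lemma Lp_fun_cong_AE:
  fixes u v :: "'a \<Rightarrow> 'b::euclidean_space"
  assumes u: "Lp_fun p \<Omega> u" and [measurable]: "v \<in> borel_measurable (lebesgue_on \<Omega>)"
    and ae: "AE x in lebesgue_on \<Omega>. v x = u x"
  shows "Lp_fun p \<Omega> v" and "Lp_norm p \<Omega> v = Lp_norm p \<Omega> u"
proof -
  have [measurable]: "u \<in> borel_measurable (lebesgue_on \<Omega>)"
    using u by (simp add: Lp_fun_def)
  have ae': "AE x in lebesgue_on \<Omega>. norm (u x) powr p = norm (v x) powr p"
    using ae by eventually_elim simp
  have "integrable (lebesgue_on \<Omega>) (\<lambda>x. norm (u x) powr p) \<longleftrightarrow> integrable (lebesgue_on \<Omega>) (\<lambda>x. norm (v x) powr p)"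
    by (rule integrable_cong_AE) (use ae' in measurable)
  then show "Lp_fun p \<Omega> v"
    using u by (simp add: Lp_fun_def)
  have "(LINT x|lebesgue_on \<Omega>. norm (v x) powr p) = (LINT x|lebesgue_on \<Omega>. norm (u x) powr p)"
    by (rule integral_cong_AE) (use ae' in \<open>auto elim: eventually_mono\<close>)
  then show "Lp_norm p \<Omega> v = Lp_norm p \<Omega> u"
    by (simp add: Lp_norm_def)
qed

lemma Lp_norm_nonneg: "0 \<le> Lp_norm p \<Omega> u"
  by (simp add: Lp_norm_def)

lemma Lp_norm_powr: "Lp_norm p \<Omega> u powr p = (LINT x|lebesgue_on \<Omega>. norm (u x) powr p)"
  using p_ge_1 by (simp add: Lp_norm_def powr_powr integral_nonneg_AE)

lemma Lp_norm_scaleR: "Lp_norm p \<Omega> (\<lambda>x. c *\<^sub>R u x) = \<bar>c\<bar> * Lp_norm p \<Omega> u"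
  unfolding Lp_norm_def by (rule norm_gauge.integral_scale)

lemma Lp_norm_lincomb:
  assumes "Lp_fun p \<Omega> u" "Lp_fun p \<Omega> v"
  shows "Lp_norm p \<Omega> (\<lambda>x. c *\<^sub>R u x + d *\<^sub>R v x) \<le> \<bar>c\<bar> * Lp_norm p \<Omega> u + \<bar>d\<bar> * Lp_norm p \<Omega> v"
  using assms unfolding Lp_norm_def Lp_fun_def by (intro norm_gauge.minkowski_lincomb) auto

lemma Lp_norm_diff:
  fixes u v :: "'a \<Rightarrow> 'b::euclidean_space"
  assumes u: "Lp_fun p \<Omega> u" and v: "Lp_fun p \<Omega> v"
  shows "\<bar>Lp_norm p \<Omega> u - Lp_norm p \<Omega> v\<bar> \<le> Lp_norm p \<Omega> (\<lambda>x. u x - v x)"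
proof -
  have w: "Lp_fun p \<Omega> (\<lambda>x. u x - v x)"
    using Lp_fun_lincomb[OF u v, of 1 "-1"] by simp
  show ?thesis
    \<comment> \<open>With w = u - v, the decompositions u = w + v and v = u - w give the two halves
      of the absolute value.\<close>
    using Lp_norm_lincomb[OF w v, of 1 1] Lp_norm_lincomb[OF u w, of 1 "-1"] by simp
qed

lemma Lp_norm_eq_0_iff:
  assumes "Lp_fun p \<Omega> u"
  shows "Lp_norm p \<Omega> u = 0 \<longleftrightarrow> (AE x in lebesgue_on \<Omega>. u x = 0)"
proof -
  have "Lp_norm p \<Omega> u = 0 \<longleftrightarrow> (LINT x|lebesgue_on \<Omega>. norm (u x) powr p) = 0"
    by (simp add: Lp_norm_def)
  also have "\<dots> \<longleftrightarrow> (AE x in lebesgue_on \<Omega>. norm (u x) powr p = 0)"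
    using assms by (intro integral_nonneg_eq_0_iff_AE) (auto simp: Lp_fun_def)
  finally show ?thesis
    by simp
qed

section \<open>Functions with a weak gradient in \<open>L^p\<close>\<close>

text \<open>\<open>weak_grad\<close> chooses among all weak gradients and not just those in
  \<open>L^p\<close>; uniqueness carries integrability over from the gradient that membership in
  \<open>W1p\<close> provides.\<close>

lemma weak_grad:
  assumes "u \<in> W1p p \<Omega>"
  shows "is_weak_gradient \<Omega> u (weak_grad \<Omega> u)" and "Lp_fun p \<Omega> (weak_grad \<Omega> u)" and "Lp_fun p \<Omega> u"
proof -
  obtain g where g: "is_weak_gradient \<Omega> u g" "Lp_fun p \<Omega> g" and u: "Lp_fun p \<Omega> u"
    using assms by (auto simp: W1p_def)
  show wg: "is_weak_gradient \<Omega> u (weak_grad \<Omega> u)"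
    unfolding weak_grad_def by (rule someI[of "is_weak_gradient \<Omega> u", OF g(1)])
  have "AE x in lebesgue_on \<Omega>. weak_grad \<Omega> u x = g x"
    by (rule is_weak_gradient_unique[OF g(1) wg]) simp
  moreover have "weak_grad \<Omega> u \<in> borel_measurable (lebesgue_on \<Omega>)"
    using wg by (intro borel_measurable_locally_integrable open_domain) (simp add: is_weak_gradient_def)
  ultimately show "Lp_fun p \<Omega> (weak_grad \<Omega> u)"
    using Lp_fun_cong_AE(1)[OF g(2)] by blast
  show "Lp_fun p \<Omega> u"
    by (rule u)
qed

lemma borel_measurable_W1p:
  "u \<in> W1p p \<Omega> \<Longrightarrow> u \<in> borel_measurable (lebesgue_on \<Omega>)"
  "u \<in> W1p p \<Omega> \<Longrightarrow> weak_grad \<Omega> u \<in> borel_measurable (lebesgue_on \<Omega>)"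
  using weak_grad(2,3) by (auto simp: Lp_fun_def)

lemma W1p_lincomb:
  assumes u: "u \<in> W1p p \<Omega>" and v: "v \<in> W1p p \<Omega>"
  shows "(\<lambda>x. c * u x + d * v x) \<in> W1p p \<Omega>"
    and "AE x in lebesgue_on \<Omega>. weak_grad \<Omega> (\<lambda>x. c * u x + d * v x) x = c *\<^sub>R weak_grad \<Omega> u x + d *\<^sub>R weak_grad \<Omega> v x"
proof -
  note wg = is_weak_gradient_lincomb[OF weak_grad(1)[OF u] weak_grad(1)[OF v], of c d]
  show W: "(\<lambda>x. c * u x + d * v x) \<in> W1p p \<Omega>"
    using wg Lp_fun_lincomb[OF weak_grad(2)[OF u] weak_grad(2)[OF v], of c d]
      Lp_fun_lincomb[OF weak_grad(3)[OF u] weak_grad(3)[OF v], of c d]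
    by (auto simp: W1p_def)
  show "AE x in lebesgue_on \<Omega>. weak_grad \<Omega> (\<lambda>x. c * u x + d * v x) x = c *\<^sub>R weak_grad \<Omega> u x + d *\<^sub>R weak_grad \<Omega> v x"
    by (rule is_weak_gradient_unique[OF wg weak_grad(1)[OF W]]) simp
qed

lemma W1p_diff: "u \<in> W1p p \<Omega> \<Longrightarrow> v \<in> W1p p \<Omega> \<Longrightarrow> (\<lambda>x. u x - v x) \<in> W1p p \<Omega>"
  using W1p_lincomb(1)[of u v 1 "-1"] by simp

lemma W1p_cong_AE:
  assumes u: "u \<in> W1p p \<Omega>" and v: "v \<in> borel_measurable (lebesgue_on \<Omega>)"
    and ae: "AE x in lebesgue_on \<Omega>. v x = u x"
  shows "v \<in> W1p p \<Omega>" and "AE x in lebesgue_on \<Omega>. weak_grad \<Omega> v x = weak_grad \<Omega> u x"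
    and "W1p_norm p \<Omega> v = W1p_norm p \<Omega> u"
proof -
  have wg: "is_weak_gradient \<Omega> v (weak_grad \<Omega> u)"
    by (rule is_weak_gradient_cong_AE[OF weak_grad(1)[OF u] v ae])
  show W: "v \<in> W1p p \<Omega>"
    using wg weak_grad(2)[OF u] Lp_fun_cong_AE(1)[OF weak_grad(3)[OF u] v ae] by (auto simp: W1p_def)
  show aeg: "AE x in lebesgue_on \<Omega>. weak_grad \<Omega> v x = weak_grad \<Omega> u x"
    by (rule is_weak_gradient_unique[OF wg weak_grad(1)[OF W]]) simp
  have "Lp_norm p \<Omega> v powr p = Lp_norm p \<Omega> u powr p"
    using Lp_fun_cong_AE(2)[OF weak_grad(3)[OF u] v ae] by simp
  moreover have "Lp_norm p \<Omega> (weak_grad \<Omega> v) powr p = Lp_norm p \<Omega> (weak_grad \<Omega> u) powr p"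
    using Lp_fun_cong_AE(2)[OF weak_grad(2)[OF u] borel_measurable_W1p(2)[OF W] aeg] by simp
  ultimately show "W1p_norm p \<Omega> v = W1p_norm p \<Omega> u"
    unfolding Lp_norm_powr by (simp add: W1p_norm_def)
qed

lemma W1p_norm_eq:
  assumes "u \<in> W1p p \<Omega>"
  shows "W1p_norm p \<Omega> u =
    (LINT x|lebesgue_on \<Omega>. norm (fst (u x, weak_grad \<Omega> u x)) powr p + norm (snd (u x, weak_grad \<Omega> u x)) powr p) powr (1 / p)"
    and "integrable (lebesgue_on \<Omega>) (\<lambda>x. norm (fst (u x, weak_grad \<Omega> u x)) powr p + norm (snd (u x, weak_grad \<Omega> u x)) powr p)"
  using weak_grad(2,3)[OF assms] by (auto simp: W1p_norm_def Lp_fun_def)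

lemma W1p_norm_nonneg: "0 \<le> W1p_norm p \<Omega> u"
  by (simp add: W1p_norm_def)

text \<open>Minkowski's inequality for \<open>pair_gauge\<close>, applied to the pairs of function
  and gradient. The chosen gradient of the combination equals the combination of the gradients only
  almost everywhere, so the integrals are matched first.\<close>

lemma W1p_norm_lincomb:
  assumes u: "u \<in> W1p p \<Omega>" and v: "v \<in> W1p p \<Omega>"
  shows "W1p_norm p \<Omega> (\<lambda>x. c * u x + d * v x) \<le> \<bar>c\<bar> * W1p_norm p \<Omega> u + \<bar>d\<bar> * W1p_norm p \<Omega> v"
proof -
  let ?w = "\<lambda>x. c * u x + d * v x" and ?g = "\<lambda>x. c *\<^sub>R weak_grad \<Omega> u x + d *\<^sub>R weak_grad \<Omega> v x"
  note W = W1p_lincomb[OF u v, of c d]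
  have [measurable]: "?w \<in> borel_measurable (lebesgue_on \<Omega>)" "weak_grad \<Omega> ?w \<in> borel_measurable (lebesgue_on \<Omega>)"
    "weak_grad \<Omega> u \<in> borel_measurable (lebesgue_on \<Omega>)" "weak_grad \<Omega> v \<in> borel_measurable (lebesgue_on \<Omega>)"
    using borel_measurable_W1p W(1) u v by auto
  have "(LINT x|lebesgue_on \<Omega>. norm (fst (?w x, weak_grad \<Omega> ?w x)) powr p + norm (snd (?w x, weak_grad \<Omega> ?w x)) powr p) =
      (LINT x|lebesgue_on \<Omega>. norm (fst (c *\<^sub>R (u x, weak_grad \<Omega> u x) + d *\<^sub>R (v x, weak_grad \<Omega> v x))) powr p +
        norm (snd (c *\<^sub>R (u x, weak_grad \<Omega> u x) + d *\<^sub>R (v x, weak_grad \<Omega> v x))) powr p)"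
  proof (rule integral_cong_AE)
    show "AE x in lebesgue_on \<Omega>. norm (fst (?w x, weak_grad \<Omega> ?w x)) powr p + norm (snd (?w x, weak_grad \<Omega> ?w x)) powr p =
      norm (fst (c *\<^sub>R (u x, weak_grad \<Omega> u x) + d *\<^sub>R (v x, weak_grad \<Omega> v x))) powr p +
      norm (snd (c *\<^sub>R (u x, weak_grad \<Omega> u x) + d *\<^sub>R (v x, weak_grad \<Omega> v x))) powr p"
      using W(2) by eventually_elim simp
  qed simp_all
  then show ?thesis
    using pair_gauge.minkowski_lincomb[OF W1p_norm_eq(2)[OF u] W1p_norm_eq(2)[OF v], of c d]
    unfolding W1p_norm_eq(1)[OF u] W1p_norm_eq(1)[OF v] W1p_norm_eq(1)[OF W(1)] by simp
qed

lemma W1p_norm_scale: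
  assumes "u \<in> W1p p \<Omega>"
  shows "W1p_norm p \<Omega> (\<lambda>x. c * u x) = \<bar>c\<bar> * W1p_norm p \<Omega> u"
proof (rule antisym)
  have le: "W1p_norm p \<Omega> (\<lambda>x. a * w x) \<le> \<bar>a\<bar> * W1p_norm p \<Omega> w" if "w \<in> W1p p \<Omega>" for a w
    using W1p_norm_lincomb[OF that that, of a 0] by simp
  show "W1p_norm p \<Omega> (\<lambda>x. c * u x) \<le> \<bar>c\<bar> * W1p_norm p \<Omega> u"
    by (rule le[OF assms])
  show "\<bar>c\<bar> * W1p_norm p \<Omega> u \<le> W1p_norm p \<Omega> (\<lambda>x. c * u x)"
  proof (cases "c = 0")
    case False
    have "(\<lambda>x. c * u x) \<in> W1p p \<Omega>"
      using W1p_lincomb(1)[OF assms assms, of c 0] by simp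
    \<comment> \<open>The reverse inequality is the first one, used to scale back by
      \<open>1 / c\<close>.\<close>
    from le[OF this, of "1 / c"] False have "W1p_norm p \<Omega> u \<le> W1p_norm p \<Omega> (\<lambda>x. c * u x) / \<bar>c\<bar>"
      by simp
    then show ?thesis
      using False by (simp add: field_simps)
  qed (simp add: W1p_norm_nonneg)
qed

lemma Lp_norm_le_W1p_norm:
  assumes "u \<in> W1p p \<Omega>"
  shows "Lp_norm p \<Omega> u \<le> W1p_norm p \<Omega> u" and "Lp_norm p \<Omega> (weak_grad \<Omega> u) \<le> W1p_norm p \<Omega> u"
  using p_ge_1 unfolding Lp_norm_def W1p_norm_def
  by (auto intro!: powr_mono2 integral_nonneg_AE)

text \<open>Metric spaces have a symmetric distance on the whole type, so the case without a weak
  gradient matters: there both gradients are the same arbitrary choice.\<close>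

lemma W1p_norm_uminus: "W1p_norm p \<Omega> (\<lambda>x. - u x) = W1p_norm p \<Omega> u"
proof -
  have neg: "is_weak_gradient \<Omega> (\<lambda>x. - w x) (\<lambda>x. - g x)" if "is_weak_gradient \<Omega> w g" for w g
    using is_weak_gradient_lincomb[OF that that, of "-1" 0] by simp
  have "(LINT x|lebesgue_on \<Omega>. norm (weak_grad \<Omega> (\<lambda>x. - u x) x) powr p) =
      (LINT x|lebesgue_on \<Omega>. norm (weak_grad \<Omega> u x) powr p)"
  proof (cases "\<exists>g. is_weak_gradient \<Omega> u g")
    case True
    then have wg: "is_weak_gradient \<Omega> u (weak_grad \<Omega> u)"
      unfolding weak_grad_def by (rule someI_ex)
    have wgn: "is_weak_gradient \<Omega> (\<lambda>x. - u x) (weak_grad \<Omega> (\<lambda>x. - u x))"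
      unfolding weak_grad_def by (rule someI[of "is_weak_gradient \<Omega> (\<lambda>x. - u x)", OF neg[OF wg]])
    have ae: "AE x in lebesgue_on \<Omega>. weak_grad \<Omega> (\<lambda>x. - u x) x = - weak_grad \<Omega> u x"
      by (rule is_weak_gradient_unique[OF neg[OF wg] wgn]) simp
    have [measurable]: "weak_grad \<Omega> u \<in> borel_measurable (lebesgue_on \<Omega>)"
      "weak_grad \<Omega> (\<lambda>x. - u x) \<in> borel_measurable (lebesgue_on \<Omega>)"
      using wg wgn by (auto intro!: borel_measurable_locally_integrable open_domain simp: is_weak_gradient_def)
    show ?thesis
      by (rule integral_cong_AE) (use ae in \<open>auto elim: eventually_mono\<close>)
  next
    case False
    then have "is_weak_gradient \<Omega> (\<lambda>x. - u x) = is_weak_gradient \<Omega> u"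
      using neg[of "\<lambda>x. - u x"] by (auto simp: fun_eq_iff)
    then show ?thesis
      by (simp add: weak_grad_def)
  qed
  then show ?thesis
    by (simp add: W1p_norm_def)
qed

section \<open>Test functions in the Sobolev space and their closure\<close>

text \<open>Integration by parts makes the classical gradient a weak one. \<open>W01p\<close>
  measures distances to test functions by \<open>W1p_norm\<close>, whose triangle inequality is
  available only inside \<open>W1p\<close>.\<close>

lemma test_functions_subset_W1p: "test_functions \<Omega> \<subseteq> W1p p \<Omega>"
proof
  fix \<phi> assume \<phi>: "\<phi> \<in> test_functions \<Omega>"
  let ?g = "\<lambda>x. \<Sum>b\<in>Basis. partial_deriv b \<phi> x *\<^sub>R b"
  have g: "?g \<in> compactly_supported \<Omega>"
  proof -
    have "(\<lambda>x. \<Sum>b\<in>B. partial_deriv b \<phi> x *\<^sub>R b) \<in> compactly_supported \<Omega>" if "finite B" "B \<subseteq> Basis" for B :: "'a set"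
      using that
    proof (induction rule: finite_induct)
      case empty
      then show ?case
        by (auto simp: compactly_supported_def intro!: exI[of _ "{}"])
    next
      case (insert b B)
      have "partial_deriv b \<phi> \<in> compactly_supported \<Omega>"
        using insert.prems by (intro test_functionD(3)[OF \<phi>]) auto
      then have "(\<lambda>x. partial_deriv b \<phi> x *\<^sub>R b) \<in> compactly_supported \<Omega>"
        unfolding compactly_supported_def by (force intro!: continuous_on_scaleR)
      then show ?case
        using insert by (simp add: compactly_supported_add)
    qed
    then show ?thesis
      by simp
  qed
  have "is_weak_gradient \<Omega> \<phi> ?g"
    unfolding is_weak_gradient_def
  proof (intro conjI ballI)
    show "locally_integrable \<Omega> \<phi>"
      by (rule locally_integrable_compactly_supported[OF test_functionD(2)[OF \<phi>]])
    show "locally_integrable \<Omega> ?g"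
      by (rule locally_integrable_compactly_supported[OF g])
    fix \<psi> and b :: 'a
    assume \<psi>: "\<psi> \<in> test_functions \<Omega>" and b: "b \<in> Basis"
    have "?g x \<bullet> b = partial_deriv b \<phi> x" for x
      using b by (simp add: inner_sum_left inner_Basis if_distrib cong: if_cong)
    then show "(LINT x|lebesgue_on \<Omega>. \<phi> x * partial_deriv b \<psi> x) = - (LINT x|lebesgue_on \<Omega>. ?g x \<bullet> b * \<psi> x)"
      using integration_by_parts_test_functions[OF open_domain \<phi> \<psi> b] by simp
  qed
  moreover have "Lp_fun p \<Omega> ?g" "Lp_fun p \<Omega> \<phi>"
    using p_ge_1 g test_functionD(2)[OF \<phi>] by (auto intro!: Lp_fun_compactly_supported open_domain)
  ultimately show "\<phi> \<in> W1p p \<Omega>"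
    unfolding W1p_def by blast
qed

lemma W01p_subset_W1p: "W01p p \<Omega> \<subseteq> W1p p \<Omega>"
  by (auto simp: W01p_def)

lemma W01p_lincomb:
  assumes u: "u \<in> W01p p \<Omega>" and v: "v \<in> W01p p \<Omega>"
  shows "(\<lambda>x. c * u x + d * v x) \<in> W01p p \<Omega>"
proof -
  have uv: "u \<in> W1p p \<Omega>" "v \<in> W1p p \<Omega>"
    using u v by (auto simp: W01p_def)
  obtain \<phi> \<psi> where \<phi>: "\<And>n. \<phi> n \<in> test_functions \<Omega>" "(\<lambda>n. W1p_norm p \<Omega> (\<lambda>x. u x - \<phi> n x)) \<longlonglongrightarrow> 0"
    and \<psi>: "\<And>n. \<psi> n \<in> test_functions \<Omega>" "(\<lambda>n. W1p_norm p \<Omega> (\<lambda>x. v x - \<psi> n x)) \<longlonglongrightarrow> 0"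
    using u v unfolding W01p_def by blast
  define \<xi> where "\<xi> n x = c * \<phi> n x + d * \<psi> n x" for n x
  have le: "W1p_norm p \<Omega> (\<lambda>x. (c * u x + d * v x) - \<xi> n x) \<le>
      \<bar>c\<bar> * W1p_norm p \<Omega> (\<lambda>x. u x - \<phi> n x) + \<bar>d\<bar> * W1p_norm p \<Omega> (\<lambda>x. v x - \<psi> n x)" for n
  proof -
    have "(\<lambda>x. u x - \<phi> n x) \<in> W1p p \<Omega>" "(\<lambda>x. v x - \<psi> n x) \<in> W1p p \<Omega>"
      using uv \<phi>(1) \<psi>(1) test_functions_subset_W1p by (auto intro!: W1p_diff)
    from W1p_norm_lincomb[OF this, of c d] show ?thesis
      by (simp add: \<xi>_def algebra_simps)
  qed
  have "(\<lambda>n. \<bar>c\<bar> * W1p_norm p \<Omega> (\<lambda>x. u x - \<phi> n x) + \<bar>d\<bar> * W1p_norm p \<Omega> (\<lambda>x. v x - \<psi> n x)) \<longlonglongrightarrow> \<bar>c\<bar> * 0 + \<bar>d\<bar> * 0"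
    by (intro tendsto_intros \<phi> \<psi>)
  then have "(\<lambda>n. W1p_norm p \<Omega> (\<lambda>x. (c * u x + d * v x) - \<xi> n x)) \<longlonglongrightarrow> 0"
    by (intro tendsto_sandwich[OF always_eventually[OF allI[OF W1p_norm_nonneg]]
          always_eventually[OF allI[OF le]] tendsto_const]) simp
  moreover have "\<xi> n \<in> test_functions \<Omega>" for n
    unfolding \<xi>_def[abs_def] by (rule test_functions_lincomb[OF \<phi>(1) \<psi>(1)])
  ultimately show ?thesis
    using W1p_lincomb(1)[OF uv] unfolding W01p_def by blast
qed

lemma W01p_cong_AE:
  assumes u: "u \<in> W01p p \<Omega>" and v: "v \<in> borel_measurable (lebesgue_on \<Omega>)"
    and ae: "AE x in lebesgue_on \<Omega>. v x = u x"
  shows "v \<in> W01p p \<Omega>"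
proof -
  obtain \<phi> where \<phi>: "\<And>n. \<phi> n \<in> test_functions \<Omega>" "(\<lambda>n. W1p_norm p \<Omega> (\<lambda>x. u x - \<phi> n x)) \<longlonglongrightarrow> 0"
    and u1: "u \<in> W1p p \<Omega>"
    using u unfolding W01p_def by blast
  have "W1p_norm p \<Omega> (\<lambda>x. v x - \<phi> n x) = W1p_norm p \<Omega> (\<lambda>x. u x - \<phi> n x)" for n
  proof (rule W1p_cong_AE(3))
    have \<phi>W: "\<phi> n \<in> W1p p \<Omega>"
      using \<phi>(1) test_functions_subset_W1p by auto
    then show "(\<lambda>x. u x - \<phi> n x) \<in> W1p p \<Omega>"
      using u1 by (intro W1p_diff)
    show "(\<lambda>x. v x - \<phi> n x) \<in> borel_measurable (lebesgue_on \<Omega>)"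
      using v borel_measurable_W1p(1)[OF \<phi>W] by (rule borel_measurable_diff)
    show "AE x in lebesgue_on \<Omega>. v x - \<phi> n x = u x - \<phi> n x"
      using ae by eventually_elim simp
  qed
  then show ?thesis
    using \<phi> W1p_cong_AE(1)[OF u1 v ae] unfolding W01p_def by (auto intro!: exI[of _ \<phi>])
qed

end

subsection \<open>The metric space of Sobolev classes\<close>

lemma ae_class_eqI:
  assumes "AE x in lebesgue_on \<Omega>. u x = v x"
  shows "ae_class \<Omega> u = ae_class \<Omega> v"
proof -
  have "(AE x in lebesgue_on \<Omega>. w x = u x) \<longleftrightarrow> (AE x in lebesgue_on \<Omega>. w x = v x)" for w
  proof
    assume "AE x in lebesgue_on \<Omega>. w x = u x"
    then show "AE x in lebesgue_on \<Omega>. w x = v x"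
      using assms by eventually_elim simp
  next
    assume "AE x in lebesgue_on \<Omega>. w x = v x"
    then show "AE x in lebesgue_on \<Omega>. w x = u x"
      using assms by eventually_elim simp
  qed
  then show ?thesis
    by (simp add: ae_class_def)
qed

lemma class_rep_ae_class:
  assumes "u \<in> borel_measurable (lebesgue_on \<Omega>)"
  shows "class_rep (ae_class \<Omega> u) \<in> borel_measurable (lebesgue_on \<Omega>)"
    and "AE x in lebesgue_on \<Omega>. class_rep (ae_class \<Omega> u) x = u x"
proof -
  have "u \<in> ae_class \<Omega> u"
    using assms by (simp add: ae_class_def)
  then have "class_rep (ae_class \<Omega> u) \<in> ae_class \<Omega> u"
    unfolding class_rep_def by (rule someI[of "\<lambda>w. w \<in> ae_class \<Omega> u"])
  then show "class_rep (ae_class \<Omega> u) \<in> borel_measurable (lebesgue_on \<Omega>)"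
    "AE x in lebesgue_on \<Omega>. class_rep (ae_class \<Omega> u) x = u x"
    by (simp_all add: ae_class_def)
qed

lemma class_neg_ae_class: "class_neg (ae_class \<Omega> u) = ae_class \<Omega> (\<lambda>x. - u x)"
proof (intro equalityI subsetI)
  fix w assume "w \<in> class_neg (ae_class \<Omega> u)"
  then obtain v where v: "v \<in> borel_measurable (lebesgue_on \<Omega>)" "AE x in lebesgue_on \<Omega>. v x = u x"
    and w: "w = (\<lambda>x. - v x)"
    by (auto simp: class_neg_def ae_class_def)
  have "AE x in lebesgue_on \<Omega>. - v x = - u x"
    using v(2) by eventually_elim simp
  then show "w \<in> ae_class \<Omega> (\<lambda>x. - u x)"
    using v(1) by (simp add: ae_class_def w)
next
  fix w assume "w \<in> ae_class \<Omega> (\<lambda>x. - u x)"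
  then have w: "w \<in> borel_measurable (lebesgue_on \<Omega>)" "AE x in lebesgue_on \<Omega>. w x = - u x"
    by (auto simp: ae_class_def)
  have "AE x in lebesgue_on \<Omega>. - w x = u x"
    using w(2) by eventually_elim simp
  then have "(\<lambda>x. - w x) \<in> ae_class \<Omega> u"
    using w(1) by (simp add: ae_class_def)
  moreover have "w = (\<lambda>x. - (- w x))"
    by simp
  ultimately show "w \<in> class_neg (ae_class \<Omega> u)"
    unfolding class_neg_def by (intro image_eqI[of _ _ "\<lambda>x. - w x"]) simp_all
qed

context sobolev
begin

definition class_scale :: "real \<Rightarrow> ('a \<Rightarrow> real) set \<Rightarrow> ('a \<Rightarrow> real) set" where
  "class_scale r c = ae_class \<Omega> (\<lambda>x. r * class_rep c x)"

text \<open>With \<open>slope\<close> below, a \<open>p\<close>-th root of an integral: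
  \<open>energy\<close> is \<open>slope c powr p\<close>, and the unit sphere is
  \<open>mass c = 1\<close>. The roots scale by \<bar>r\<bar> and obey a reverse triangle
  inequality.\<close>

definition mass :: "('a \<Rightarrow> real) set \<Rightarrow> real" where
  "mass c = Lp_norm p \<Omega> (class_rep c)"

definition slope :: "('a \<Rightarrow> real) set \<Rightarrow> real" where
  "slope c = Lp_norm p \<Omega> (weak_grad \<Omega> (class_rep c))"

definition normalize_class :: "('a \<Rightarrow> real) set \<Rightarrow> ('a \<Rightarrow> real) set" where
  "normalize_class c = class_scale (1 / mass c) c"

lemma class_rep_W01p:
  assumes "c \<in> sobolev_space p \<Omega>"
  shows "class_rep c \<in> W01p p \<Omega>" and "ae_class \<Omega> (class_rep c) = c"
proof -
  obtain u where u: "u \<in> W01p p \<Omega>" and c: "c = ae_class \<Omega> u"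
    using assms by (auto simp: sobolev_space_def)
  then have "u \<in> borel_measurable (lebesgue_on \<Omega>)"
    using W01p_subset_W1p borel_measurable_W1p(1) by blast
  note rep = class_rep_ae_class[OF this, folded c]
  show "class_rep c \<in> W01p p \<Omega>"
    by (rule W01p_cong_AE[OF u rep])
  show "ae_class \<Omega> (class_rep c) = c"
    using ae_class_eqI[OF rep(2)] c by simp
qed

lemma class_rep_W1p: "c \<in> sobolev_space p \<Omega> \<Longrightarrow> class_rep c \<in> W1p p \<Omega>"
  using class_rep_W01p(1) W01p_subset_W1p by blast

lemma Metric_space_sobolev: "Metric_space (sobolev_space p \<Omega>) (sobolev_dist p \<Omega>)"
proof
  fix c d e
  show "0 \<le> sobolev_dist p \<Omega> c d"
    by (simp add: sobolev_dist_def W1p_norm_nonneg)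
  show "sobolev_dist p \<Omega> c d = sobolev_dist p \<Omega> d c"
    using W1p_norm_uminus[of "\<lambda>x. class_rep c x - class_rep d x"] by (simp add: sobolev_dist_def)
  assume c: "c \<in> sobolev_space p \<Omega>" and d: "d \<in> sobolev_space p \<Omega>"
  have W: "(\<lambda>x. class_rep c x - class_rep d x) \<in> W1p p \<Omega>"
    using c d by (intro W1p_diff class_rep_W1p)
  show "sobolev_dist p \<Omega> c d = 0 \<longleftrightarrow> c = d"
  proof
    assume "sobolev_dist p \<Omega> c d = 0"
    \<comment> \<open>The \<open>L^p\<close> part of the norm alone separates classes.\<close>
    then have "Lp_norm p \<Omega> (\<lambda>x. class_rep c x - class_rep d x) = 0"
      using Lp_norm_le_W1p_norm(1)[OF W] Lp_norm_nonneg[of "\<lambda>x. class_rep c x - class_rep d x"]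
      by (simp add: sobolev_dist_def)
    then have "AE x in lebesgue_on \<Omega>. class_rep c x = class_rep d x"
      using Lp_norm_eq_0_iff[OF weak_grad(3)[OF W]] by simp
    then have "ae_class \<Omega> (class_rep c) = ae_class \<Omega> (class_rep d)"
      by (rule ae_class_eqI)
    then show "c = d"
      using class_rep_W01p(2) c d by simp
  next
    assume "c = d"
    then show "sobolev_dist p \<Omega> c d = 0"
      \<comment> \<open>The weak gradient of the zero function is itself a choice; that its norm is
        0 comes from homogeneity with the factor 0.\<close>
      using W1p_norm_scale[OF W, of 0] by (simp add: sobolev_dist_def)
  qed
  assume e: "e \<in> sobolev_space p \<Omega>"
  have V: "(\<lambda>x. class_rep d x - class_rep e x) \<in> W1p p \<Omega>"
    using d e by (intro W1p_diff class_rep_W1p)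
  show "sobolev_dist p \<Omega> c e \<le> sobolev_dist p \<Omega> c d + sobolev_dist p \<Omega> d e"
    using W1p_norm_lincomb[OF W V, of 1 1] by (simp add: sobolev_dist_def)
qed

sublocale Metric_space "sobolev_space p \<Omega>" "sobolev_dist p \<Omega>"
  rewrites "Metric_space.mtopology (sobolev_space p \<Omega>) (sobolev_dist p \<Omega>) = sobolev_topology p \<Omega>"
  by (simp_all add: Metric_space_sobolev sobolev_topology_def)

lemma class_scale_rep:
  assumes "c \<in> sobolev_space p \<Omega>"
  shows "class_scale r c \<in> sobolev_space p \<Omega>"
    and "AE x in lebesgue_on \<Omega>. class_rep (class_scale r c) x = r * class_rep c x"
proof -
  have W: "(\<lambda>x. r * class_rep c x) \<in> W01p p \<Omega>"
    using W01p_lincomb[OF class_rep_W01p(1)[OF assms] class_rep_W01p(1)[OF assms], of r 0] by simp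
  then show "class_scale r c \<in> sobolev_space p \<Omega>"
    by (auto simp: class_scale_def sobolev_space_def)
  have "(\<lambda>x. r * class_rep c x) \<in> borel_measurable (lebesgue_on \<Omega>)"
    using W W01p_subset_W1p borel_measurable_W1p(1) by blast
  then show "AE x in lebesgue_on \<Omega>. class_rep (class_scale r c) x = r * class_rep c x"
    unfolding class_scale_def by (rule class_rep_ae_class(2))
qed

lemma class_scale_scale:
  assumes "c \<in> sobolev_space p \<Omega>"
  shows "class_scale r (class_scale s c) = class_scale (r * s) c"
  unfolding class_scale_def[of r] class_scale_def[of "r * s"]
  by (rule ae_class_eqI, use class_scale_rep(2)[OF assms, of s] in eventually_elim) simp

text \<open>Turns every question about symmetry and oddness into one about scaling.\<close>

lemma class_neg_eq:
  assumes "c \<in> sobolev_space p \<Omega>"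
  shows "class_neg c = class_scale (- 1) c"
  using class_neg_ae_class[of \<Omega> "class_rep c"] class_rep_W01p(2)[OF assms] by (simp add: class_scale_def)

lemma mass_class_scale:
  assumes c: "c \<in> sobolev_space p \<Omega>"
  shows "mass (class_scale r c) = \<bar>r\<bar> * mass c"
proof -
  have "Lp_norm p \<Omega> (class_rep (class_scale r c)) = Lp_norm p \<Omega> (\<lambda>x. r *\<^sub>R class_rep c x)"
  proof (rule Lp_fun_cong_AE(2))
    show "Lp_fun p \<Omega> (\<lambda>x. r *\<^sub>R class_rep c x)"
      using Lp_fun_lincomb[OF weak_grad(3) weak_grad(3), OF class_rep_W1p[OF c] class_rep_W1p[OF c], of r 0] by simp
  qed (use class_scale_rep[OF c] borel_measurable_W1p(1) class_rep_W1p in auto)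
  then show ?thesis
    unfolding mass_def Lp_norm_scaleR .
qed

text \<open>Two choices intervene, the representative of the scaled class and the weak gradient of
  the scaled function; each costs one almost-everywhere identity, and the two are chained.\<close>

lemma slope_class_scale:
  assumes c: "c \<in> sobolev_space p \<Omega>"
  shows "slope (class_scale r c) = \<bar>r\<bar> * slope c"
proof -
  let ?u = "class_rep c"
  have u: "?u \<in> W1p p \<Omega>"
    by (rule class_rep_W1p[OF c])
  have ru: "(\<lambda>x. r * ?u x) \<in> W1p p \<Omega>"
    using W1p_lincomb(1)[OF u u, of r 0] by simp
  have v: "class_rep (class_scale r c) \<in> W1p p \<Omega>"
    using c by (intro class_rep_W1p class_scale_rep)
  have "AE x in lebesgue_on \<Omega>. weak_grad \<Omega> (class_rep (class_scale r c)) x = weak_grad \<Omega> (\<lambda>x. r * ?u x) x"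
    by (rule W1p_cong_AE(2)[OF ru borel_measurable_W1p(1)[OF v] class_scale_rep(2)[OF c]])
  moreover have "AE x in lebesgue_on \<Omega>. weak_grad \<Omega> (\<lambda>x. r * ?u x) x = r *\<^sub>R weak_grad \<Omega> ?u x"
    using W1p_lincomb(2)[OF u u, of r 0] by simp
  ultimately have ae: "AE x in lebesgue_on \<Omega>. weak_grad \<Omega> (class_rep (class_scale r c)) x = r *\<^sub>R weak_grad \<Omega> ?u x"
    by eventually_elim simp
  have "Lp_norm p \<Omega> (weak_grad \<Omega> (class_rep (class_scale r c))) = Lp_norm p \<Omega> (\<lambda>x. r *\<^sub>R weak_grad \<Omega> ?u x)"
  proof (rule Lp_fun_cong_AE(2)[OF _ borel_measurable_W1p(2)[OF v] ae])
    show "Lp_fun p \<Omega> (\<lambda>x. r *\<^sub>R weak_grad \<Omega> ?u x)"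
      using Lp_fun_lincomb[OF weak_grad(2)[OF u] weak_grad(2)[OF u], of r 0] by simp
  qed
  then show ?thesis
    unfolding slope_def Lp_norm_scaleR .
qed

lemma mass_nonneg: "0 \<le> mass c" and slope_nonneg: "0 \<le> slope c"
  by (simp_all add: mass_def slope_def Lp_norm_nonneg)

lemma energy_eq: "energy p \<Omega> c = slope c powr p"
  by (simp add: energy_def slope_def Lp_norm_powr)

lemma sobolev_sphere_iff: "c \<in> sobolev_sphere p \<Omega> \<longleftrightarrow> c \<in> sobolev_space p \<Omega> \<and> mass c = 1"
proof -
  have "(LINT x|lebesgue_on \<Omega>. \<bar>class_rep c x\<bar> powr p) = mass c powr p"
    by (simp add: mass_def Lp_norm_powr)
  moreover have "mass c powr p = 1 \<longleftrightarrow> mass c = 1"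
  proof
    assume "mass c powr p = 1"
    then have "(mass c powr p) powr (1 / p) = 1"
      by simp
    then show "mass c = 1"
      using p_ge_1 mass_nonneg[of c] by (simp add: powr_powr)
  qed simp
  ultimately show ?thesis
    by (simp add: sobolev_sphere_def)
qed

lemma mass_eq_0_iff:
  assumes c: "c \<in> sobolev_space p \<Omega>"
  shows "mass c = 0 \<longleftrightarrow> c = ae_class \<Omega> (\<lambda>_. 0)"
proof
  assume "mass c = 0"
  then have "AE x in lebesgue_on \<Omega>. class_rep c x = 0"
    using Lp_norm_eq_0_iff[OF weak_grad(3)[OF class_rep_W1p[OF c]]] by (simp add: mass_def)
  then have "ae_class \<Omega> (class_rep c) = ae_class \<Omega> (\<lambda>_. 0)"
    by (rule ae_class_eqI)
  then show "c = ae_class \<Omega> (\<lambda>_. 0)"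
    using class_rep_W01p(2)[OF c] by simp
next
  assume "c = ae_class \<Omega> (\<lambda>_. 0)"
  then have "AE x in lebesgue_on \<Omega>. class_rep c x = 0"
    using class_rep_ae_class(2)[of "\<lambda>_. 0" \<Omega>] by simp
  then show "mass c = 0"
    using Lp_norm_eq_0_iff[OF weak_grad(3)[OF class_rep_W1p[OF c]]] by (simp add: mass_def)
qed

lemma mass_diff_le_dist:
  assumes "c \<in> sobolev_space p \<Omega>" "d \<in> sobolev_space p \<Omega>"
  shows "\<bar>mass c - mass d\<bar> \<le> sobolev_dist p \<Omega> c d"
proof -
  note W = class_rep_W1p[OF assms(1)] class_rep_W1p[OF assms(2)]
  show ?thesis
    unfolding mass_def sobolev_dist_def
    by (rule order_trans[OF Lp_norm_diff[OF weak_grad(3)[OF W(1)] weak_grad(3)[OF W(2)]]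
          Lp_norm_le_W1p_norm(1)[OF W1p_diff[OF W]]])
qed

text \<open>The reverse triangle inequality for the gradients in \<open>L^p\<close>; the difference
  of the chosen gradients agrees almost everywhere with the chosen gradient of the difference, which
  \<open>W1p_norm\<close> controls.\<close>

lemma slope_diff_le_dist:
  assumes "c \<in> sobolev_space p \<Omega>" "d \<in> sobolev_space p \<Omega>"
  shows "\<bar>slope c - slope d\<bar> \<le> sobolev_dist p \<Omega> c d"
proof -
  note W = class_rep_W1p[OF assms(1)] class_rep_W1p[OF assms(2)]
  note D = W1p_diff[OF W]
  have ae: "AE x in lebesgue_on \<Omega>. weak_grad \<Omega> (\<lambda>x. class_rep c x - class_rep d x) x =
      weak_grad \<Omega> (class_rep c) x - weak_grad \<Omega> (class_rep d) x"
    using W1p_lincomb(2)[OF W, of 1 "- 1"] by simp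
  have "Lp_fun p \<Omega> (\<lambda>x. weak_grad \<Omega> (class_rep c) x - weak_grad \<Omega> (class_rep d) x)"
    using Lp_fun_lincomb[OF weak_grad(2)[OF W(1)] weak_grad(2)[OF W(2)], of 1 "- 1"] by simp
  note eq = Lp_fun_cong_AE(2)[OF this borel_measurable_W1p(2)[OF D] ae]
  show ?thesis
    unfolding slope_def sobolev_dist_def
    by (rule order_trans[OF Lp_norm_diff[OF weak_grad(2)[OF W(1)] weak_grad(2)[OF W(2)]]
          ord_eq_le_trans[OF eq[symmetric] Lp_norm_le_W1p_norm(2)[OF D]]])
qed

section \<open>Continuity of mass, slope and normalization\<close>

lemma continuous_map_real_if_diff_le_dist:
  fixes f :: "('a \<Rightarrow> real) set \<Rightarrow> real"
  assumes "\<And>c d. c \<in> sobolev_space p \<Omega> \<Longrightarrow> d \<in> sobolev_space p \<Omega> \<Longrightarrow> \<bar>f c - f d\<bar> \<le> sobolev_dist p \<Omega> c d"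
  shows "continuous_map (sobolev_topology p \<Omega>) euclideanreal f"
proof -
  have "continuous_map (sobolev_topology p \<Omega>) Met_TC.mtopology f"
    unfolding metric_continuous_map[OF Met_TC.Metric_space_axioms]
  proof (intro conjI ballI allI impI)
    fix a and e :: real
    assume a: "a \<in> sobolev_space p \<Omega>" and "0 < e"
    then show "\<exists>\<delta>>0. \<forall>x. x \<in> sobolev_space p \<Omega> \<and> sobolev_dist p \<Omega> a x < \<delta> \<longrightarrow> dist (f a) (f x) < e"
      using assms[OF a] by (intro exI[of _ e]) (auto simp: dist_real_def intro: le_less_trans)
  qed simp
  then show ?thesis
    by simp
qed

text \<open>Comes from r u - s v = (r - s) u + s (u - v), and gives joint continuity of
  scaling.\<close>

lemma sobolev_dist_class_scale_le:
  assumes c: "c \<in> sobolev_space p \<Omega>" and d: "d \<in> sobolev_space p \<Omega>"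
  shows "sobolev_dist p \<Omega> (class_scale r c) (class_scale s d) \<le>
    \<bar>r - s\<bar> * W1p_norm p \<Omega> (class_rep c) + \<bar>s\<bar> * sobolev_dist p \<Omega> c d"
proof -
  let ?u = "class_rep c" and ?v = "class_rep d"
  note u = class_rep_W1p[OF c] and v = class_rep_W1p[OF d]
  note uv = W1p_diff[OF u v]
  have W: "(\<lambda>x. (r - s) * ?u x + s * (?u x - ?v x)) \<in> W1p p \<Omega>"
    by (rule W1p_lincomb(1)[OF u uv])
  have "sobolev_dist p \<Omega> (class_scale r c) (class_scale s d) =
      W1p_norm p \<Omega> (\<lambda>x. (r - s) * ?u x + s * (?u x - ?v x))"
    unfolding sobolev_dist_def
  proof (rule W1p_cong_AE(3)[OF W])
    show "(\<lambda>x. class_rep (class_scale r c) x - class_rep (class_scale s d) x) \<in> borel_measurable (lebesgue_on \<Omega>)"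
      using c d by (intro borel_measurable_W1p(1) W1p_diff class_rep_W1p class_scale_rep(1))
    show "AE x in lebesgue_on \<Omega>. class_rep (class_scale r c) x - class_rep (class_scale s d) x =
        (r - s) * ?u x + s * (?u x - ?v x)"
      using class_scale_rep(2)[OF c, of r] class_scale_rep(2)[OF d, of s]
      by eventually_elim (simp add: algebra_simps)
  qed
  then show ?thesis
    using W1p_norm_lincomb[OF u uv, of "r - s" s] by (simp add: sobolev_dist_def)
qed

lemma continuous_map_normalize_class:
  "continuous_map (subtopology (sobolev_topology p \<Omega>) (sobolev_nonzero p \<Omega>)) (sobolev_topology p \<Omega>) normalize_class"
proof -
  interpret nonzero: Submetric "sobolev_space p \<Omega>" "sobolev_dist p \<Omega>" "sobolev_nonzero p \<Omega>"
    by unfold_locales (auto simp: sobolev_nonzero_def)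
  have pos: "0 < mass c" if "c \<in> sobolev_nonzero p \<Omega>" for c
    using that mass_eq_0_iff[of c] mass_nonneg[of c] by (auto simp: sobolev_nonzero_def less_le)
  have "continuous_map nonzero.sub.mtopology (Metric_space.mtopology (sobolev_space p \<Omega>) (sobolev_dist p \<Omega>)) normalize_class"
    unfolding nonzero.sub.metric_continuous_map[OF Metric_space_sobolev]
  proof (intro conjI ballI allI impI)
    show "normalize_class ` sobolev_nonzero p \<Omega> \<subseteq> sobolev_space p \<Omega>"
      by (auto simp: normalize_class_def sobolev_nonzero_def class_scale_rep(1))
  next
    fix c and e :: real
    assume cn: "c \<in> sobolev_nonzero p \<Omega>" and "0 < e"
    then have c: "c \<in> sobolev_space p \<Omega>" and m: "0 < mass c"
      using pos by (auto simp: sobolev_nonzero_def)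
    \<comment> \<open>Within distance \<open>mass c / 2\<close> of \<open>c\<close> the mass stays
      above \<open>mass c / 2\<close>. Then the reciprocal masses differ by at most 2/(mass c)^2
      times the distance and 1/(mass x) is at most 2/(mass c);
      \<open>sobolev_dist_class_scale_le\<close> combines both into the Lipschitz constant
      \<open>C\<close> at \<open>c\<close>.\<close>
    define C where "C = 2 * W1p_norm p \<Omega> (class_rep c) / (mass c)\<^sup>2 + 2 / mass c"
    have C: "0 < C"
      unfolding C_def using m by (intro add_nonneg_pos divide_nonneg_pos) (auto simp: W1p_norm_nonneg)
    have "sobolev_dist p \<Omega> (normalize_class c) (normalize_class x) < e"
      if xn: "x \<in> sobolev_nonzero p \<Omega>" and d1: "sobolev_dist p \<Omega> c x < mass c / 2"
        and d2: "sobolev_dist p \<Omega> c x < e / C" for x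
    proof -
      let ?d = "sobolev_dist p \<Omega> c x"
      have x: "x \<in> sobolev_space p \<Omega>" and mx: "0 < mass x"
        using xn pos by (auto simp: sobolev_nonzero_def)
      have diff: "\<bar>mass c - mass x\<bar> \<le> ?d"
        by (rule mass_diff_le_dist[OF c x])
      have half: "mass c / 2 \<le> mass x"
        using diff d1 by linarith
      have inv: "1 / mass x \<le> 2 / mass c"
        using half m mx by (simp add: field_simps)
      have "\<bar>1 / mass c - 1 / mass x\<bar> = \<bar>mass c - mass x\<bar> / mass c * (1 / mass x)"
        using m mx by (simp add: diff_frac_eq abs_mult abs_minus_commute)
      also have "\<dots> \<le> ?d / mass c * (2 / mass c)"
        using inv diff m mx by (intro mult_mono divide_right_mono) auto
      finally have "\<bar>1 / mass c - 1 / mass x\<bar> \<le> ?d * (2 / (mass c)\<^sup>2)"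
        by (simp add: power2_eq_square)
      then have "\<bar>1 / mass c - 1 / mass x\<bar> * W1p_norm p \<Omega> (class_rep c) + \<bar>1 / mass x\<bar> * ?d
          \<le> ?d * (2 / (mass c)\<^sup>2) * W1p_norm p \<Omega> (class_rep c) + 2 / mass c * ?d"
        using inv mx by (intro add_mono mult_right_mono) (auto simp: W1p_norm_nonneg)
      also have "\<dots> = ?d * C"
        by (simp add: C_def algebra_simps)
      also have "\<dots> < e"
        using d2 C by (simp add: field_simps)
      finally show ?thesis
        using sobolev_dist_class_scale_le[OF c x, of "1 / mass c" "1 / mass x"] by (simp add: normalize_class_def)
    qed
    then show "\<exists>\<delta>>0. \<forall>x. x \<in> sobolev_nonzero p \<Omega> \<and> sobolev_dist p \<Omega> c x < \<delta> \<longrightarrow>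
        sobolev_dist p \<Omega> (normalize_class c) (normalize_class x) < e"
      using m C \<open>0 < e\<close> by (intro exI[of _ "min (mass c / 2) (e / C)"]) auto
  qed
  then show ?thesis
    by (simp add: nonzero.mtopology_submetric flip: sobolev_topology_def)
qed

lemma normalize_class:
  assumes c: "c \<in> sobolev_space p \<Omega>" and "mass c \<noteq> 0"
  shows "normalize_class c \<in> sobolev_sphere p \<Omega>"
    and "slope (normalize_class c) = slope c / mass c"
    and "normalize_class (class_neg c) = class_neg (normalize_class c)"
proof -
  have m: "0 < mass c"
    using assms(2) mass_nonneg[of c] by linarith
  show "normalize_class c \<in> sobolev_sphere p \<Omega>"
    unfolding sobolev_sphere_iff normalize_class_def mass_class_scale[OF c]
    using m class_scale_rep(1)[OF c] by simp
  show "slope (normalize_class c) = slope c / mass c"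
    unfolding normalize_class_def slope_class_scale[OF c] using m by simp
  show "normalize_class (class_neg c) = class_neg (normalize_class c)"
    unfolding normalize_class_def class_neg_eq[OF c] class_neg_eq[OF class_scale_rep(1)[OF c]]
      mass_class_scale[OF c] class_scale_scale[OF c] by simp
qed

end

subsection \<open>Comparison of the variational eigenvalues\<close>

text \<open>The ambient space has infinitely many coordinates, so compactness comes from Tychonoff's
  theorem: the sphere is closed in the product topology and lies in a product of intervals
  [-1, 1].\<close>

lemma compact_space_nsphere: "compact_space (nsphere n)"
proof -
  let ?P = "powertop_real (UNIV :: nat set)"
  let ?S = "{x. (\<Sum>i\<le>n. x i ^ 2) = 1} \<inter> (\<Inter>i\<in>{n<..}. {x. x i = 0})"
  have cl: "closedin ?P {x. f x = c}" if "continuous_map ?P euclideanreal f" for f c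
    using closedin_continuous_map_preimage[OF that, of "{c}"] by (simp flip: closed_closedin)
  have "closedin ?P {x. (\<Sum>i\<le>n. x i ^ 2) = 1}" "closedin ?P {x. x i = 0}" for i
    by (intro cl continuous_intros continuous_map_product_projection; simp)+
  then have clS: "closedin ?P ?S"
    by (intro closedin_Int closedin_INT) auto
  have box: "compactin ?P (PiE UNIV (\<lambda>_. {- 1..1}))"
    by (simp add: compactin_PiE)
  have sub: "?S \<subseteq> PiE UNIV (\<lambda>_. {- 1..1::real})"
  proof
    fix x :: "nat \<Rightarrow> real"
    assume x: "x \<in> ?S"
    have "\<bar>x i\<bar> \<le> 1" for i
    proof (cases "i \<le> n")
      case True
      then have "x i ^ 2 \<le> (\<Sum>i\<le>n. x i ^ 2)"
        by (intro member_le_sum) auto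
      then show ?thesis
        using x by (simp add: abs_square_le_1)
    next
      case False
      then show ?thesis
        using x by auto
    qed
    then show "x \<in> PiE UNIV (\<lambda>_. {- 1..1})"
      by (auto simp: abs_le_iff minus_le_iff)
  qed
  have "?S = {x::nat \<Rightarrow> real. (\<Sum>i\<le>n. x i ^ 2) = 1 \<and> (\<forall>i>n. x i = 0)}"
    by auto
  then show ?thesis
    unfolding nsphere using compact_space_subtopology[OF closed_compactin[OF box sub clS]] by simp
qed

lemma topspace_nsphere:
  "topspace (nsphere n) = {x. (\<Sum>i\<le>n. x i ^ 2) = 1 \<and> (\<forall>i>n. x i = 0)}"
  by (simp add: nsphere)

text \<open>Points of \<open>nsphere\<close> are sequences that vanish beyond the last coordinate,
  so an equator is literally a subset and restricting a map to it needs no embedding.\<close>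

lemma nsphere_subtopology_le:
  assumes "k \<le> m"
  shows "nsphere k = subtopology (nsphere m) (topspace (nsphere k))"
    and "topspace (nsphere k) \<subseteq> topspace (nsphere m)"
proof -
  show sub: "topspace (nsphere k) \<subseteq> topspace (nsphere m)"
  proof
    fix x assume x: "x \<in> topspace (nsphere k)"
    have "(\<Sum>i\<le>k. x i ^ 2) = (\<Sum>i\<le>m. x i ^ 2)"
      using assms x by (intro sum.mono_neutral_left) (auto simp: topspace_nsphere)
    then show "x \<in> topspace (nsphere m)"
      using assms x by (auto simp: topspace_nsphere)
  qed
  show "nsphere k = subtopology (nsphere m) (topspace (nsphere k))"
    using sub unfolding topspace_nsphere nsphere subtopology_subtopology by (simp add: Int_absorb1)
qed

lemma uminus_in_nsphere: "x \<in> topspace (nsphere n) \<Longrightarrow> (\<lambda>i. - x i) \<in> topspace (nsphere n)"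
  by (simp add: topspace_nsphere)

section \<open>Odd maps and the two cogenera\<close>

lemma odd_map_mono:
  assumes "odd_map p \<Omega> m A h" "A \<subseteq> B"
  shows "odd_map p \<Omega> m B h"
  using assms unfolding odd_map_def continuous_map_in_subtopology by blast

lemma odd_map_in: "odd_map p \<Omega> m A h \<Longrightarrow> x \<in> topspace (nsphere (m - 1)) \<Longrightarrow> h x \<in> A"
  unfolding odd_map_def continuous_map_in_subtopology by blast

lemma odd_map_restrict:
  assumes h: "odd_map p \<Omega> m A h" and "k \<le> m"
  shows "odd_map p \<Omega> k A h"
proof -
  have le: "k - 1 \<le> m - 1"
    using \<open>k \<le> m\<close> by simp
  have "continuous_map (nsphere (k - 1)) (subtopology (sobolev_topology p \<Omega>) A) h"
    using h unfolding odd_map_def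
    by (subst nsphere_subtopology_le(1)[OF le]) (auto intro: continuous_map_from_subtopology)
  then show ?thesis
    using h nsphere_subtopology_le(2)[OF le] unfolding odd_map_def by blast
qed

text \<open>An odd map into \<open>A\<close> is also one into every neighbourhood of
  \<open>A\<close>, so the second supremum runs over more numbers.\<close>

lemma cogenus_le_reg_cogenus: "cogenus p \<Omega> A \<le> reg_cogenus p \<Omega> A"
  unfolding cogenus_def reg_cogenus_def symmetric_nhds_def
  by (rule Sup_subset_mono) (auto intro: odd_map_mono)

lemma lambda_C_le_lambda_F: "lambda_C k p \<Omega> \<le> lambda_F k p \<Omega>"
  unfolding lambda_C_def lambda_F_def minimax_def
  by (rule INF_superset_mono) (auto intro: order_trans[OF _ cogenus_le_reg_cogenus])

lemma lambda_F_le_lambda_DR: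
  assumes "1 \<le> k"
  shows "lambda_F k p \<Omega> \<le> lambda_DR k p \<Omega>"
  unfolding lambda_F_def lambda_DR_def minimax_def
proof (rule INF_superset_mono)
  show "{h ` topspace (nsphere (k - 1)) |h. odd_map p \<Omega> k (sobolev_sphere p \<Omega>) h}
      \<subseteq> {A \<in> compact_symmetric_sets p \<Omega>. enat k \<le> cogenus p \<Omega> A}"
  proof clarify
    fix h assume h: "odd_map p \<Omega> k (sobolev_sphere p \<Omega>) h"
    let ?A = "h ` topspace (nsphere (k - 1))"
    have cont: "continuous_map (nsphere (k - 1)) (sobolev_topology p \<Omega>) h"
      using h by (simp add: odd_map_def continuous_map_in_subtopology)
    have "compactin (sobolev_topology p \<Omega>) ?A"
      using compact_space_nsphere cont by (intro image_compactin) (auto simp: compact_space_def)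
    moreover have "symmetric_set ?A"
      unfolding symmetric_set_def
    proof clarify
      fix x assume x: "x \<in> topspace (nsphere (k - 1))"
      then have "class_neg (h x) = h (\<lambda>i. - x i)"
        using h by (simp add: odd_map_def)
      then show "class_neg (h x) \<in> ?A"
        using uminus_in_nsphere[OF x] by (rule image_eqI)
    qed
    moreover have "?A \<subseteq> sobolev_sphere p \<Omega>"
      using odd_map_in[OF h] by blast
    ultimately have "?A \<in> compact_symmetric_sets p \<Omega>"
      by (simp add: compact_symmetric_sets_def)
    moreover have "odd_map p \<Omega> k ?A h"
      \<comment> \<open>The same \<open>h\<close>, with its own image as target, witnesses the bound
        on the cogenus.\<close>
      using h by (auto simp: odd_map_def continuous_map_in_subtopology)
    then have "enat k \<le> cogenus p \<Omega> ?A"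
      unfolding cogenus_def using assms by (intro Sup_upper) auto
    ultimately show "?A \<in> compact_symmetric_sets p \<Omega> \<and> enat k \<le> cogenus p \<Omega> ?A"
      by blast
  qed
qed simp

text \<open>If every admissible number were below \<open>k\<close>, then \<open>k - 1\<close> would
  bound the supremum. For \<open>k = 0\<close> the empty family, with supremum 0, would be a
  counterexample.\<close>

lemma enat_le_SupD:
  assumes "enat k \<le> Sup {enat m | m. P m}" "1 \<le> k"
  obtains m where "P m" "k \<le> m"
proof -
  have "\<exists>m. P m \<and> k \<le> m"
  proof (rule ccontr)
    assume "\<not> ?thesis"
    then have "Sup {enat m | m. P m} \<le> enat (k - 1)"
      by (intro Sup_least) force
    from order_trans[OF assms(1) this] show False
      using \<open>1 \<le> k\<close> by simp
  qed
  then show ?thesis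
    using that by blast
qed

section \<open>From the regularized cogenus to odd maps into the sphere\<close>

context sobolev
begin

text \<open>This neighbourhood avoids \<open>0\<close> because \<open>slope\<close> is nonnegative; after normalization its points
  have slope below \<open>l\<close>.\<close>

lemma sublevel_in_symmetric_nhds:
  assumes "\<And>c. c \<in> A \<Longrightarrow> c \<in> sobolev_space p \<Omega> \<and> slope c < l * mass c"
  shows "{c \<in> sobolev_space p \<Omega>. slope c < l * mass c} \<in> symmetric_nhds p \<Omega> A"
proof -
  let ?U = "{c \<in> sobolev_space p \<Omega>. slope c < l * mass c}"
  have "continuous_map (sobolev_topology p \<Omega>) euclideanreal (\<lambda>c. l * mass c - slope c)"
    by (intro continuous_map_diff continuous_map_real_mult_left continuous_map_real_if_diff_le_dist
        mass_diff_le_dist slope_diff_le_dist)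
  then have "openin (sobolev_topology p \<Omega>) {c \<in> topspace (sobolev_topology p \<Omega>). l * mass c - slope c \<in> {0<..}}"
    by (rule openin_continuous_map_preimage) simp
  then have op: "openin (sobolev_topology p \<Omega>) ?U"
    by simp
  have nz: "?U \<subseteq> sobolev_nonzero p \<Omega>"
  proof
    fix c assume c: "c \<in> ?U"
    then have "mass c \<noteq> 0"
      using slope_nonneg[of c] by auto
    then show "c \<in> sobolev_nonzero p \<Omega>"
      using c mass_eq_0_iff[of c] by (auto simp: sobolev_nonzero_def)
  qed
  have "openin (subtopology (sobolev_topology p \<Omega>) (sobolev_nonzero p \<Omega>)) ?U"
    using openin_subtopology_Int2[OF op, of "sobolev_nonzero p \<Omega>"] Int_absorb1[OF nz] by simp
  moreover have "symmetric_set ?U"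
    unfolding symmetric_set_def
    by (auto simp: class_neg_eq class_scale_rep(1) mass_class_scale slope_class_scale)
  ultimately show ?thesis
    using assms by (auto simp: symmetric_nhds_def)
qed

lemma lambda_DR_le_lambda_C:
  assumes k: "1 \<le> k"
  shows "lambda_DR k p \<Omega> \<le> lambda_C k p \<Omega>"
  unfolding lambda_C_def minimax_def
proof (rule INF_greatest)
  fix A assume A: "A \<in> {A \<in> compact_symmetric_sets p \<Omega>. enat k \<le> reg_cogenus p \<Omega> A}"
  then have sphere: "c \<in> sobolev_space p \<Omega>" "mass c = 1" if "c \<in> A" for c
    using that by (auto simp: compact_symmetric_sets_def sobolev_sphere_iff)
  have "enat k \<le> Sup {enat m | m. 1 \<le> m \<and> (\<forall>U\<in>symmetric_nhds p \<Omega> A. \<exists>h. odd_map p \<Omega> m U h)}"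
    using A by (simp add: reg_cogenus_def)
  then obtain m where m: "1 \<le> m \<and> (\<forall>U\<in>symmetric_nhds p \<Omega> A. \<exists>h. odd_map p \<Omega> m U h)" and km: "k \<le> m"
    using k by (rule enat_le_SupD)
  have nhds: "\<exists>h. odd_map p \<Omega> m U h" if "U \<in> symmetric_nhds p \<Omega> A" for U
    using m that by auto
  \<comment> \<open>The empty set would be a neighbourhood of itself, yet no map goes from a
    nonempty sphere into it. A point of \<open>A\<close> is what makes the bound \<open>L\<close>
    positive.\<close>
  have "A \<noteq> {}"
  proof
    assume "A = {}"
    then have "{} \<in> symmetric_nhds p \<Omega> A"
      by (simp add: symmetric_nhds_def symmetric_set_def)
    then obtain h where "odd_map p \<Omega> m {} h"
      using nhds by blast
    then show False
      using odd_map_in[OF _ in_topspace_nsphere] by blast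
  qed
  show "lambda_DR k p \<Omega> \<le> (SUP c\<in>A. ereal (energy p \<Omega> c))"
  \<comment> \<open>The strict inequality \<open>SUP < z\<close> puts all of \<open>A\<close> into
    the open sublevel set for \<open>z\<close>. Of the infinite values, \<infinity> is trivial and
    its negative contradicts the strict inequality.\<close>
  proof (rule dense_ge)
    fix z assume z: "(SUP c\<in>A. ereal (energy p \<Omega> c)) < z"
    show "lambda_DR k p \<Omega> \<le> z"
    proof (cases z)
      case (real L)
      have less: "slope c powr p < L" if "c \<in> A" for c
        using le_less_trans[OF SUP_upper[OF that] z] by (simp add: real energy_eq)
      then have "0 < L"
        using \<open>A \<noteq> {}\<close> by (metis ex_in_conv le_less_trans powr_ge_zero)
      \<comment> \<open>\<open>L\<close> bounds energies, which are \<open>p\<close>-th powers of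
        slopes, so \<open>l\<close> is the matching bound for slopes.\<close>
      define l where "l = L powr (1 / p)"
      have l: "l powr p = L"
        using \<open>0 < L\<close> p_ge_1 by (simp add: l_def powr_powr)
      have "slope c < l" if "c \<in> A" for c
      proof -
        have "(slope c powr p) powr (1 / p) < L powr (1 / p)"
          using less[OF that] p_ge_1 by (intro powr_less_mono2) auto
        then show ?thesis
          using slope_nonneg[of c] p_ge_1 by (simp add: l_def powr_powr)
      qed
      then have UN: "{c \<in> sobolev_space p \<Omega>. slope c < l * mass c} \<in> symmetric_nhds p \<Omega> A" (is "?U \<in> _")
        using sphere by (intro sublevel_in_symmetric_nhds) simp
      then have U: "?U \<subseteq> sobolev_nonzero p \<Omega>"
        unfolding symmetric_nhds_def using openin_imp_subset by blast
      obtain h' where "odd_map p \<Omega> m ?U h'"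
        using nhds[OF UN] by blast
      \<comment> \<open>The supremum only provides some \<open>m\<close> with
        \<open>k \<le> m\<close>, whereas \<open>lambda_DR\<close> asks for exactly
        \<open>k\<close>; the equator repairs this.\<close>
      then have h': "odd_map p \<Omega> k ?U h'"
        using km by (rule odd_map_restrict)
      define h where "h = normalize_class \<circ> h'"
      have hU: "h' x \<in> ?U" "mass (h' x) \<noteq> 0" if "x \<in> topspace (nsphere (k - 1))" for x
      proof -
        show "h' x \<in> ?U"
          using odd_map_in[OF h' that] .
        then show "mass (h' x) \<noteq> 0"
          using slope_nonneg[of "h' x"] by auto
      qed
      have "odd_map p \<Omega> k (sobolev_sphere p \<Omega>) h"
        unfolding odd_map_def
      proof (intro conjI ballI)
        have "continuous_map (nsphere (k - 1)) (subtopology (sobolev_topology p \<Omega>) (sobolev_nonzero p \<Omega>)) h'"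
          using odd_map_mono[OF h' U] by (simp add: odd_map_def)
        then have "continuous_map (nsphere (k - 1)) (sobolev_topology p \<Omega>) h"
          unfolding h_def by (rule continuous_map_compose[OF _ continuous_map_normalize_class])
        then show "continuous_map (nsphere (k - 1)) (subtopology (sobolev_topology p \<Omega>) (sobolev_sphere p \<Omega>)) h"
          using hU normalize_class(1) by (intro continuous_map_into_subtopology) (auto simp: h_def)
        show "h (\<lambda>i. - x i) = class_neg (h x)" if "x \<in> topspace (nsphere (k - 1))" for x
          using h' hU[OF that] normalize_class(3)[of "h' x"] that by (simp add: h_def odd_map_def)
      qed
      then have "lambda_DR k p \<Omega> \<le> (SUP c\<in>h ` topspace (nsphere (k - 1)). ereal (energy p \<Omega> c))"
        unfolding lambda_DR_def minimax_def by (intro INF_lower) blast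
      also have "\<dots> \<le> z"
      proof (rule SUP_least)
        fix c assume "c \<in> h ` topspace (nsphere (k - 1))"
        then obtain x where x: "x \<in> topspace (nsphere (k - 1))" and c: "c = normalize_class (h' x)"
          by (auto simp: h_def)
        have "0 < mass (h' x)"
          using hU(2)[OF x] mass_nonneg[of "h' x"] by linarith
        then have "slope c \<le> l"
          using hU[OF x] by (simp add: c normalize_class(2) field_simps)
        then have "slope c powr p \<le> l powr p"
          using slope_nonneg p_ge_1 by (intro powr_mono2) auto
        then show "ereal (energy p \<Omega> c) \<le> z"
          by (simp add: real energy_eq l)
      qed
      finally show ?thesis .
    qed (use z in auto)
  qed
qed

end

theorem lemma1p4:
  fixes \<Omega> :: "(real ^ 'n) set" and p :: real and k :: nat
  assumes "2 \<le> CARD('n)"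
    and "1 < p"
    and "bounded_lipschitz_domain \<Omega>"
    and "1 \<le> k"
  shows "lambda_DR k p \<Omega> = lambda_F k p \<Omega> \<and> lambda_F k p \<Omega> = lambda_C k p \<Omega>"
proof -
  interpret sobolev \<Omega> p
    using assms by unfold_locales (auto simp: bounded_lipschitz_domain_def)
  show ?thesis
    using lambda_DR_le_lambda_C[OF \<open>1 \<le> k\<close>] lambda_C_le_lambda_F[of k p \<Omega>]
      lambda_F_le_lambda_DR[OF \<open>1 \<le> k\<close>, of p \<Omega>] by auto
qed

end
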